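(* Let $H$ be a trigraph. If the underlying graph of $H$ has an induced subgraph of girth at least $7$ which is a subdivision of $K_4$, then $\operatorname{tww}(H)\geq 3$.
   Context: A trigraph has vertex set and disjoint black and red edge sets; its underlying graph uses all edges. Contracting distinct $u,v$ gives a new vertex $x$ with $xy$ black if $uy,vy$ both black, absent if neither is an edge, red otherwise; $\operatorname{tww}(H)$ is the least $d$ such that some sequence of contractions down to one vertex keeps every trigraph's maximum red degree at most $d$. A subdivision of $K_4$ is obtained by replacing its edges by internally disjoint paths. *)

theory Defs
  imports Main "HOL-Library.Extended_Nat"
begin

record 'a ugraph =
  verts :: "'a set"
  edges :: "'a set set"

definition induced_subgraph :: "'a ugraph \<Rightarrow> 'a ugraph \<Rightarrow> bool" where
  "induced_subgraph G' G \<longleftrightarrow>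
     verts G' \<subseteq> verts G \<and> edges G' = {e \<in> edges G. e \<subseteq> verts G'}"

definition complete_graph :: "nat \<Rightarrow> nat ugraph" where
  "complete_graph n = \<lparr>verts = {..<n}, edges = {e. e \<subseteq> {..<n} \<and> card e = 2}\<rparr>"

definition path_edges :: "'a list \<Rightarrow> 'a set set" where
  "path_edges p = {{p ! i, p ! Suc i} | i. Suc i < length p}"

text \<open>A cycle is given by the cyclic sequence of its pairwise distinct vertices; its length is
  the length of that list.\<close>

definition is_cycle :: "'a ugraph \<Rightarrow> 'a list \<Rightarrow> bool" where
  "is_cycle G c \<longleftrightarrow>
     3 \<le> length c \<and> distinct c \<and> set c \<subseteq> verts G \<and>
     path_edges c \<subseteq> edges G \<and> {last c, hd c} \<in> edges G"

text \<open>The girth of an acyclic graph is \<open>\<infinity>\<close>.\<close>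

definition girth :: "'a ugraph \<Rightarrow> enat" where
  "girth G = Inf {enat (length c) | c. is_cycle G c}"

definition inner_verts :: "'a list \<Rightarrow> 'a set" where
  "inner_verts p = set (butlast (tl p))"

text \<open>Here \<open>b\<close> sends the vertices of \<open>K\<close> to the branch vertices of \<open>G\<close>, and \<open>P e\<close> is the path
  (listed from one end to the other, with at least one edge) that replaces the edge \<open>e\<close>.\<close>

definition is_subdivision :: "'a ugraph \<Rightarrow> 'b ugraph \<Rightarrow> bool" where
  "is_subdivision G K \<longleftrightarrow>
     (\<exists>(b :: 'b \<Rightarrow> 'a) (P :: 'b set \<Rightarrow> 'a list).
        inj_on b (verts K) \<and>
        (\<forall>e \<in> edges K. 2 \<le> length (P e) \<and> distinct (P e) \<and>
                       {hd (P e), last (P e)} = b ` e \<and>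
                       inner_verts (P e) \<inter> b ` verts K = {}) \<and>
        (\<forall>e \<in> edges K. \<forall>f \<in> edges K. e \<noteq> f \<longrightarrow>
                       inner_verts (P e) \<inter> inner_verts (P f) = {}) \<and>
        verts G = b ` verts K \<union> (\<Union>e \<in> edges K. set (P e)) \<and>
        edges G = (\<Union>e \<in> edges K. path_edges (P e)))"

record 'a trigraph =
  tverts :: "'a set"
  black :: "'a set set"
  red :: "'a set set"

definition trigraph :: "'a trigraph \<Rightarrow> bool" where
  "trigraph H \<longleftrightarrow>
     finite (tverts H) \<and>
     (\<forall>e \<in> black H \<union> red H. e \<subseteq> tverts H \<and> card e = 2) \<and>
     black H \<inter> red H = {}"

definition underlying_graph :: "'a trigraph \<Rightarrow> 'a ugraph" where
  "underlying_graph H = \<lparr>verts = tverts H, edges = black H \<union> red H\<rparr>"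

definition contract :: "'a trigraph \<Rightarrow> 'a \<Rightarrow> 'a \<Rightarrow> 'a \<Rightarrow> 'a trigraph" where
  "contract H u v x =
     \<lparr>tverts = insert x (tverts H - {u, v}),
      black = {e \<in> black H. u \<notin> e \<and> v \<notin> e} \<union>
        {{x, y} | y. y \<in> tverts H - {u, v} \<and> {u, y} \<in> black H \<and> {v, y} \<in> black H},
      red = {e \<in> red H. u \<notin> e \<and> v \<notin> e} \<union>
        {{x, y} | y. y \<in> tverts H - {u, v} \<and>
           ({u, y} \<in> black H \<union> red H \<or> {v, y} \<in> black H \<union> red H) \<and>
           \<not> ({u, y} \<in> black H \<and> {v, y} \<in> black H)}\<rparr>"

text \<open>The vertex \<open>x\<close> created by a contraction only has to differ from the surviving vertices; it
  may reuse the name \<open>u\<close> or \<open>v\<close>. Hence contractions are possible even if \<open>tverts H\<close> exhausts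
  the type.\<close>

definition contraction :: "'a trigraph \<Rightarrow> 'a trigraph \<Rightarrow> bool" where
  "contraction H H' \<longleftrightarrow>
     (\<exists>u v x. u \<in> tverts H \<and> v \<in> tverts H \<and> u \<noteq> v \<and> x \<notin> tverts H - {u, v} \<and>
        H' = contract H u v x)"

definition contraction_sequence :: "'a trigraph \<Rightarrow> 'a trigraph list \<Rightarrow> bool" where
  "contraction_sequence H Hs \<longleftrightarrow>
     Hs \<noteq> [] \<and> hd Hs = H \<and>
     (\<forall>i. Suc i < length Hs \<longrightarrow> contraction (Hs ! i) (Hs ! Suc i)) \<and>
     card (tverts (last Hs)) = 1"

definition red_degree :: "'a trigraph \<Rightarrow> 'a \<Rightarrow> nat" where
  "red_degree H v = card {y \<in> tverts H. {v, y} \<in> red H}"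

definition max_red_degree :: "'a trigraph \<Rightarrow> nat" where
  "max_red_degree H = Max (red_degree H ` tverts H)"

definition tww :: "'a trigraph \<Rightarrow> nat" where
  "tww H = (LEAST d. \<exists>Hs. contraction_sequence H Hs \<and> (\<forall>H' \<in> set Hs. max_red_degree H' \<le> d))"

lemma trigraph_contract:
  assumes H: "trigraph H" and u: "u \<in> tverts H" and v: "v \<in> tverts H"
    and x: "x \<notin> tverts H - {u, v}"
  shows "trigraph (contract H u v x)"
proof -
  have E: "e \<subseteq> tverts H" "card e = 2" if "e \<in> black H \<or> e \<in> red H" for e
    using H that by (auto simp: trigraph_def)
  have D: "black H \<inter> red H = {}" using H by (simp add: trigraph_def)
  have nx: "x \<notin> e" if "e \<in> black H \<or> e \<in> red H" "u \<notin> e" "v \<notin> e" for e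
    using E(1)[OF that(1)] that x by blast
  have c2: "card {x, y} = 2" if "y \<in> tverts H" "y \<noteq> u" "y \<noteq> v" for y
    using that x by (subst card_2_iff) blast
  have "finite (tverts (contract H u v x))"
    using H by (simp add: trigraph_def contract_def)
  moreover have "e \<subseteq> tverts (contract H u v x) \<and> card e = 2"
    if "e \<in> black (contract H u v x) \<union> red (contract H u v x)" for e
    using that E c2 unfolding contract_def by auto
  moreover have "black (contract H u v x) \<inter> red (contract H u v x) = {}"
    using D nx unfolding contract_def by (auto simp: doubleton_eq_iff)
  ultimately show ?thesis unfolding trigraph_def by blast
qed

lemma ex_contraction_sequence:
  assumes "trigraph H" and "tverts H \<noteq> {}"
  shows "\<exists>Hs. contraction_sequence H Hs"
  using assms
proof (induction "card (tverts H)" arbitrary: H rule: less_induct)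
  case less
  have fin: "finite (tverts H)" using less.prems by (simp add: trigraph_def)
  show ?case
  proof (cases "card (tverts H) = 1")
    case True
    then have "contraction_sequence H [H]" by (simp add: contraction_sequence_def)
    then show ?thesis by blast
  next
    case False
    obtain u where u: "u \<in> tverts H" using less.prems by blast
    have "tverts H \<noteq> {u}" using False by auto
    then obtain v where v: "v \<in> tverts H" "u \<noteq> v" using u by blast
    let ?H' = "contract H u v u"
    have tv: "tverts ?H' = tverts H - {v}" using u v by (auto simp: contract_def)
    have "card (tverts ?H') < card (tverts H)"
      unfolding tv using fin v(1) by (rule card_Diff1_less)
    moreover have "trigraph ?H'" using trigraph_contract[OF less.prems(1) u v(1)] by simp
    moreover have "tverts ?H' \<noteq> {}" using tv u v by auto
    ultimately obtain Hs where Hs: "contraction_sequence ?H' Hs" using less.hyps by blast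
    have c: "contraction H ?H'" unfolding contraction_def using u v by blast
    have "contraction_sequence H (H # Hs)"
      using Hs c unfolding contraction_sequence_def
      by (auto simp: nth_Cons hd_conv_nth split: nat.split)
    then show ?thesis by blast
  qed
qed

lemma tww_le_iff:
  assumes "trigraph H" and "tverts H \<noteq> {}"
  shows "tww H \<le> d \<longleftrightarrow>
    (\<exists>Hs. contraction_sequence H Hs \<and> (\<forall>H' \<in> set Hs. max_red_degree H' \<le> d))"
    (is "_ \<longleftrightarrow> ?P d")
proof
  obtain Hs where "contraction_sequence H Hs" using ex_contraction_sequence[OF assms] by blast
  then have "?P (Max (max_red_degree ` set Hs))" by (intro exI[of _ Hs]) auto
  then have "?P (tww H)" unfolding tww_def by (rule LeastI)
  then show "?P d" if "tww H \<le> d" using that order_trans by blast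
  show "tww H \<le> d" if "?P d" unfolding tww_def using that by (rule Least_le)
qed

end

theory Submission imports Defs begin

text \<open>
  Call a subgraph without vertices of degree 0 or 1 a core. A subdivision of $K_4$ has all degrees
  in $\{2, 3\}$ and every core of it contains at least three vertices of degree 3. If the girth is at
  least 7, then moreover every core is heavy: it has a vertex of degree 2 with both edges red, or its
  number of vertices plus twice its number of vertices at which two of its red edges meet is
  at least 7. These properties survive every contraction that keeps the red degrees at most 2. Heaviness
  of triangles and 4-cycles leaves only three kinds of such contractions: of two adjacent vertices
  of degree 2, or of two vertices of degree 2 with a unique common neighbour, joined to it by black
  edges, where this neighbour has degree 2 or 3. The first two kinds shorten a path of the
  subdivision and create a vertex of degree 2 with two red edges; the third one moves a branch vertex and
  trades two vertices of a core for a red turn. Hence the sequence never reaches a single vertex.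
\<close>

section \<open>Robust trigraphs\<close>

text \<open>The girth itself is no invariant, since contractions shorten cycles. Heaviness replaces
  it, and each alternative records what pays for lost vertices. Shortening a path leaves a vertex of
  degree 2 with two red edges; later contractions either avoid such a vertex or put another one on
  the same path, so a core through it needs no further count. Moving a branch vertex can cost a core
  two vertices, hence a red turn has weight 2. The bound 7 is what 4-cycles demand: with one red
  turn they reach only 4 + 2 = 6, so this turn must lie at a vertex of degree 2. The condition on
  vertices of degree 3 complements this: it leaves no vertex of degree 2 in a triangle and at most
  one in a 4-cycle, so that neighbourhoods are too large to be merged cheaply. The other obstacle is
  the rest of \<open>H\<close>: outside vertices may be merged into the subdivision and turn its
  edges red. The subdivision is therefore tracked by relations of its own. Every tracked red edge is
  red in \<open>H\<close>, but not conversely, so that the bound on red degrees is inherited while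
  additional red edges of \<open>H\<close> do no harm.\<close>

definition deg :: "('a \<Rightarrow> 'a \<Rightarrow> bool) \<Rightarrow> 'a \<Rightarrow> nat" where
  "deg E x = card {y. E x y}"

definition non_isolated :: "('a \<Rightarrow> 'a \<Rightarrow> bool) \<Rightarrow> 'a set" where
  "non_isolated F = {x. \<exists>y. F x y}"

text \<open>Cores are taken as edge relations rather than as vertex sets, because a red chord between
  two vertices of a cycle must not contribute to \<open>red_turns\<close>.\<close>

definition core :: "('a \<Rightarrow> 'a \<Rightarrow> bool) \<Rightarrow> bool" where
  "core F \<longleftrightarrow> (\<exists>x y. F x y) \<and> (\<forall>x y. F x y \<longrightarrow> F y x) \<and>
     (\<forall>x y. F x y \<longrightarrow> (\<exists>z. z \<noteq> y \<and> F x z))"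

definition red_turns :: "('a \<Rightarrow> 'a \<Rightarrow> bool) \<Rightarrow> ('a \<Rightarrow> 'a \<Rightarrow> bool) \<Rightarrow> 'a set" where
  "red_turns F R = {x. \<exists>y z. y \<noteq> z \<and> F x y \<and> R x y \<and> F x z \<and> R x z}"

text \<open>The degree of \<open>v\<close> is taken in \<open>E\<close>, not in \<open>F\<close>:
  both edges of \<open>E\<close> at \<open>v\<close> lie in \<open>F\<close> and are red.\<close>

definition heavy :: "('a \<Rightarrow> 'a \<Rightarrow> bool) \<Rightarrow> ('a \<Rightarrow> 'a \<Rightarrow> bool) \<Rightarrow> ('a \<Rightarrow> 'a \<Rightarrow> bool) \<Rightarrow> bool" where
  "heavy E R F \<longleftrightarrow> (\<exists>v\<in>red_turns F R. deg E v = 2) \<or>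
     7 \<le> card (non_isolated F) + 2 * card (red_turns F R)"

text \<open>Edges of \<open>E\<close> outside \<open>R\<close> count as black. The last two
  conditions range over all cores inside \<open>E\<close>; they pass through a contraction by
  lifting each core of the new relation to a core of the old one.\<close>

locale robust_trigraph =
  fixes V :: "'a set" and E R :: "'a \<Rightarrow> 'a \<Rightarrow> bool"
  assumes finite_V: "finite V"
    and V_nonempty: "V \<noteq> {}"
    and sym: "E x y \<Longrightarrow> E y x"
    and irrefl: "\<not> E x x"
    and edge_in: "E x y \<Longrightarrow> x \<in> V"
    and red_sym: "R x y \<Longrightarrow> R y x"
    and red_edge: "R x y \<Longrightarrow> E x y"
    and deg_2_3: "x \<in> V \<Longrightarrow> deg E x = 2 \<or> deg E x = 3"
    and red_deg: "x \<in> V \<Longrightarrow> deg R x \<le> 2"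
    and core_branch: "F \<le> E \<Longrightarrow> core F \<Longrightarrow> 3 \<le> card {v\<in>non_isolated F. deg E v = 3}"
    and core_heavy: "F \<le> E \<Longrightarrow> core F \<Longrightarrow> heavy E R F"
begin

lemma edge_in': "E x y \<Longrightarrow> y \<in> V"
  using edge_in sym by blast

lemma finite_nbrs: "finite {y. E x y}"
  by (rule finite_subset[OF _ finite_V]) (auto intro: edge_in')

lemma finite_red_nbrs: "finite {y. R x y}"
  by (rule finite_subset[OF _ finite_nbrs]) (auto intro: red_edge)

lemma three_red:
  assumes "R x p" "R x q" "R x r" shows "\<not> distinct [p, q, r]"
proof
  assume "distinct [p, q, r]"
  then have "card {p, q, r} = 3" by auto
  moreover have "card {p, q, r} \<le> deg R x"
    unfolding deg_def using assms by (intro card_mono finite_red_nbrs) auto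
  ultimately show False using red_deg[of x] assms red_edge edge_in by fastforce
qed

lemma finite_red_turns:
  assumes "F \<le> E"
  shows "finite (red_turns F R)"
proof -
  have "red_turns F R \<subseteq> V" using assms edge_in unfolding red_turns_def by blast
  then show ?thesis using finite_V finite_subset by blast
qed

text \<open>All three vertices have degree 3 by \<open>core_branch\<close>, which excludes the first
  alternative of heaviness. Then 3 + 2k \<ge> 7 forces k \<ge> 2 red turns, and two turns of a
  triangle use all of its edges.\<close>

lemma triangle:
  assumes "E p q" "E q r" "E p r"
  shows "R p q" "R q r" "R p r" "deg E p = 3" "deg E q = 3" "deg E r = 3"
proof -
  define F where "F x y \<longleftrightarrow> x \<in> {p, q, r} \<and> y \<in> {p, q, r} \<and> x \<noteq> y" for x y
  have d: "p \<noteq> q" "q \<noteq> r" "p \<noteq> r" using assms irrefl by auto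
  have FE: "F \<le> E" using assms sym by (auto simp: F_def)
  have core: "core F"
    using d unfolding core_def F_def by auto
  have ni: "non_isolated F = {p, q, r}"
    using d unfolding non_isolated_def F_def by auto
  have c3: "card {p, q, r} = 3" using d by auto
  have "{v\<in>{p, q, r}. deg E v = 3} = {p, q, r}"
    using core_branch[OF FE core] c3 unfolding ni by (intro card_seteq) auto
  then show deg3: "deg E p = 3" "deg E q = 3" "deg E r = 3" by auto
  have rt: "red_turns F R \<subseteq> {p, q, r}" unfolding red_turns_def F_def by auto
  then have two: "2 \<le> card (red_turns F R)"
    using core_heavy[OF FE core] deg3 c3 unfolding heavy_def ni by auto
  \<comment> \<open>For each edge, taking \<open>w\<close> to be the opposite vertex yields a red
    turn at an end of that edge, and the turn contains the edge.\<close>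
  have one: "\<exists>v\<in>{p, q, r}. v \<noteq> w \<and> v \<in> red_turns F R" for w
  proof (rule ccontr)
    assume "\<not> ?thesis"
    then have "red_turns F R \<subseteq> {w}" using rt by blast
    then have "card (red_turns F R) \<le> card {w}" by (intro card_mono) auto
    then show False using two by simp
  qed
  show "R p q" using one[of r] d red_sym unfolding red_turns_def F_def by auto
  show "R q r" using one[of p] d red_sym unfolding red_turns_def F_def by auto
  show "R p r" using one[of q] d red_sym unfolding red_turns_def F_def by auto
qed

context
  fixes u v p q
  assumes four: "E u p" "E v p" "E u q" "E v q" "u \<noteq> v" "p \<noteq> q"
begin

text \<open>The pairs \<open>u\<close>, \<open>v\<close> and \<open>p\<close>, \<open>q\<close> are
  opposite; their chords are left out even if they belong to \<open>E\<close>.\<close>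

definition four_cycle :: "'a \<Rightarrow> 'a \<Rightarrow> bool" where
  "four_cycle x y \<longleftrightarrow> x \<in> {u, v} \<and> y \<in> {p, q} \<or> y \<in> {u, v} \<and> x \<in> {p, q}"

lemma four_cycle: "four_cycle \<le> E" "core four_cycle" "non_isolated four_cycle = {u, p, v, q}"
  "card {u, p, v, q} = 4"
proof -
  have d: "u \<noteq> p" "u \<noteq> q" "v \<noteq> p" "v \<noteq> q" using four irrefl by auto
  show "four_cycle \<le> E" using four sym by (auto simp: four_cycle_def)
  have "\<exists>z. z \<noteq> y \<and> four_cycle x z" if "four_cycle x y" for x y
    using that four(5,6) unfolding four_cycle_def by (metis insert_iff)
  moreover have "four_cycle u p" "four_cycle x y \<Longrightarrow> four_cycle y x" for x y
    unfolding four_cycle_def by auto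
  ultimately show "core four_cycle" unfolding core_def by blast
  show "non_isolated four_cycle = {u, p, v, q}"
    unfolding non_isolated_def four_cycle_def by auto
  show "card {u, p, v, q} = 4" using four(5,6) d by simp
qed

text \<open>At least three of the four vertices have degree 3, so at most one is an
  exception.\<close>

lemma four_cycle_branch:
  assumes "x \<in> {u, p, v, q}" "y \<in> {u, p, v, q}" "x \<noteq> y"
  shows "deg E x = 3 \<or> deg E y = 3"
proof (rule ccontr)
  assume "\<not> ?thesis"
  then have "{w\<in>{u, p, v, q}. deg E w = 3} \<subseteq> {u, p, v, q} - {x, y}" by auto
  then have "card {w\<in>{u, p, v, q}. deg E w = 3} \<le> card ({u, p, v, q} - {x, y})"
    by (intro card_mono) auto
  also have "\<dots> = card {u, p, v, q} - card {x, y}" using assms by (intro card_Diff_subset) auto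
  also have "\<dots> = 2" using four_cycle(4) assms(3) by simp
  finally show False using core_branch[OF four_cycle(1,2)] unfolding four_cycle(3) by simp
qed

text \<open>The two black edges at \<open>p\<close> rule out red turns at \<open>u\<close>,
  \<open>v\<close> and \<open>p\<close>. A turn at \<open>q\<close> alone gives at most 4 + 2 = 6 <
  7, so heaviness must come from a vertex of degree 2, which can only be \<open>q\<close>.\<close>

lemma four_cycle_black:
  assumes "\<not> R u p" "\<not> R v p"
  shows "deg E q = 2 \<and> R u q \<and> R v q"
proof -
  have nr: "\<not> R p u" "\<not> R p v" using assms red_sym by blast+
  have only: "red_turns four_cycle R \<subseteq> {q}"
    using nr assms four irrefl unfolding red_turns_def four_cycle_def by auto
  then have "card (red_turns four_cycle R) \<le> card {q}" by (intro card_mono) auto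
  then have "\<exists>x\<in>red_turns four_cycle R. deg E x = 2"
    using core_heavy[OF four_cycle(1,2)] four_cycle(4) unfolding heavy_def four_cycle(3) by auto
  then have "deg E q = 2" "q \<in> red_turns four_cycle R" using only by auto
  then show ?thesis using four irrefl red_sym unfolding red_turns_def four_cycle_def by auto
qed

end

lemma deg_2_nbrs:
  assumes "deg E x = 2" "E x y"
  obtains z where "{w. E x w} = {y, z}" "y \<noteq> z"
proof -
  obtain s t where st: "{w. E x w} = {s, t}" "s \<noteq> t"
    using assms(1) unfolding deg_def card_2_iff by blast
  then have "y = s \<or> y = t" using assms(2) by blast
  then show ?thesis using that[of s] that[of t] st by (metis insert_commute)
qed

text \<open>The set in \<open>le\<close> consists of the red neighbours that the contracted vertex
  would have. With \<open>A\<close>, \<open>B\<close> the neighbourhoods outside the pair and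
  \<open>K\<close> the common black neighbours, the bound becomes |A| + |B| \<le> 2 + |K| + |A
  \<inter> B|. The short cycles keep the right side small, the degrees keep the left side
  large.\<close>

lemma contractible_pair:
  assumes a: "a \<in> V" and b: "b \<in> V" and ab: "a \<noteq> b"
    and le: "card {y. y \<noteq> a \<and> y \<noteq> b \<and> (E a y \<or> E b y) \<and>
      \<not> (E a y \<and> \<not> R a y \<and> E b y \<and> \<not> R b y)} \<le> 2"
  shows "(\<exists>a' b'. {y. E a y} = {b, a'} \<and> {y. E b y} = {a, b'} \<and> distinct [a, b, a', b']) \<or>
    (\<exists>w a' b'. {y. E a y} = {w, a'} \<and> {y. E b y} = {w, b'} \<and> distinct [a, b, w, a', b'] \<and>
       \<not> R a w \<and> \<not> R b w)"
proof -
  define A where "A = {y. E a y} - {b}"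
  define B where "B = {y. E b y} - {a}"
  define K where "K = {y \<in> A \<inter> B. \<not> R a y \<and> \<not> R b y}"
  have fin: "finite A" "finite B" "finite K" unfolding A_def B_def K_def using finite_nbrs by auto
  have KAB: "K \<subseteq> A \<inter> B" by (auto simp: K_def)
  have "{y. y \<noteq> a \<and> y \<noteq> b \<and> (E a y \<or> E b y) \<and>
      \<not> (E a y \<and> \<not> R a y \<and> E b y \<and> \<not> R b y)} = (A \<union> B) - K"
    unfolding A_def B_def K_def using irrefl by auto
  then have "card (A \<union> B) - card K \<le> 2"
    using le card_Diff_subset[of K "A \<union> B"] KAB fin by (metis le_infI1 le_supI1 sup_ge1 inf_le1 order_trans)
  moreover have "card A + card B = card (A \<union> B) + card (A \<inter> B)"
    using fin by (intro card_Un_Int)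
  ultimately have sum: "card A + card B \<le> 2 + card K + card (A \<inter> B)" by linarith
  have KC: "card K \<le> card (A \<inter> B)" using KAB fin by (intro card_mono) auto
  have CA: "card (A \<inter> B) \<le> card A" "card (A \<inter> B) \<le> card B"
    using fin by (auto intro: card_mono)
  have dom: "y \<noteq> a" "y \<noteq> b" "E a y" "E b y" if "y \<in> A \<inter> B" for y
    using that irrefl by (auto simp: A_def B_def)
  show ?thesis
  proof (cases "E a b")
    case True
    then have ba: "E b a" using sym by blast
    have cA: "card A = deg E a - 1" and cB: "card B = deg E b - 1"
      unfolding A_def B_def deg_def using True ba finite_nbrs by (auto simp: card_Diff_singleton)
    have redc: "R a y" "R b y" "deg E a = 3" "deg E b = 3" "R a b" if "y \<in> A \<inter> B" for y
      using triangle[OF True dom(4)[OF that] dom(3)[OF that]] by auto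
    then have K0: "K = {}" by (auto simp: K_def)
    \<comment> \<open>A common neighbour closes a triangle, so all its edges are red and
      \<open>a\<close>, \<open>b\<close> have degree 3. The count then forces a second common
      neighbour, and \<open>a\<close> gets three red edges.\<close>
    have C0: "A \<inter> B = {}"
    proof (rule ccontr)
      assume "A \<inter> B \<noteq> {}"
      then obtain y where y: "y \<in> A \<inter> B" by blast
      then have "card A = 2" "card B = 2" using cA cB redc[OF y] by auto
      then have "2 \<le> card (A \<inter> B)" using sum K0 by simp
      then obtain z where z: "z \<in> A \<inter> B" "z \<noteq> y" using y
        by (metis card_1_singleton_iff card_le_Suc0_iff_eq fin(1) finite_Int not_less_eq_eq numeral_2_eq_2)
      show False using three_red[of a b y z] redc[OF y] redc[OF z(1)] dom[OF y] dom[OF z(1)] z(2) by auto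
    qed
    then have "deg E a = 2" "deg E b = 2"
      using sum K0 cA cB deg_2_3[OF a] deg_2_3[OF b] by auto
    then obtain a' b' where a': "{y. E a y} = {b, a'}" "b \<noteq> a'" and b': "{y. E b y} = {a, b'}" "a \<noteq> b'"
      using deg_2_nbrs True ba by metis
    have "a' \<noteq> a" "b' \<noteq> b" using a' b' irrefl by auto
    moreover have "a' \<noteq> b'" using C0 a' b' ab calculation unfolding A_def B_def by auto
    ultimately have "distinct [a, b, a', b']" using a' b' ab by auto
    then show ?thesis using a' b' by blast
  next
    case False
    then have ba: "\<not> E b a" using sym by blast
    have AN: "A = {y. E a y}" and BN: "B = {y. E b y}" using False ba by (auto simp: A_def B_def)
    have cA: "card A = deg E a" and cB: "card B = deg E b" by (auto simp: AN BN deg_def)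
    have dA: "card A = 2 \<or> card A = 3" "card B = 2 \<or> card B = 3"
      using deg_2_3[OF a] deg_2_3[OF b] cA cB by auto
    have C1: "card (A \<inter> B) \<le> 1"
    proof (rule ccontr)
      assume "\<not> ?thesis"
      then have C2: "2 \<le> card (A \<inter> B)" by simp
      have other: "\<exists>q \<in> A \<inter> B. q \<noteq> p" for p
        using C2 by (metis card_1_singleton_iff card_le_Suc0_iff_eq fin(1) finite_Int not_less_eq_eq numeral_2_eq_2)
      have deg5: "deg E a = 3 \<or> deg E b = 3"
      proof -
        obtain p q where "p \<in> A \<inter> B" "q \<in> A \<inter> B" "q \<noteq> p" using other by blast
        then show ?thesis using four_cycle_branch[where u=a and v=b and p=p and q=q and x=a and y=b] dom[of p] dom[of q] ab by auto
      qed
      show False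
      \<comment> \<open>Without common black neighbours the union of \<open>A\<close> and
        \<open>B\<close> has at most two elements, but one of \<open>a\<close>, \<open>b\<close> has
        three neighbours.\<close>
      proof (cases "K = {}")
        case True
        then show False using sum CA dA deg5 cA cB by auto
      next
        case False
        then obtain p where p: "p \<in> A \<inter> B" "\<not> R a p" "\<not> R b p" by (auto simp: K_def)
        \<comment> \<open>Any further common neighbour has degree 2. By
          \<open>four_cycle_branch\<close> there is just one, \<open>q\<close>, and it is the only
          exception on its 4-cycle. So \<open>a\<close> and \<open>b\<close> have degree 3, and the
          count would read 6 \<le> 2 + 1 + 2.\<close>
        have bad: "deg E q = 2" "R a q" if "q \<in> A \<inter> B" "q \<noteq> p" for q
          using four_cycle_black[where u=a and v=b and p=p and q=q] p dom[OF p(1)] dom[OF that(1)] that ab by auto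
        obtain q where q: "q \<in> A \<inter> B" "q \<noteq> p" using other by blast
        have uniq: "r = q" if "r \<in> A \<inter> B" "r \<noteq> p" for r
        proof (rule ccontr)
          assume "r \<noteq> q"
          then show False
            using four_cycle_branch[where u=a and v=b and p=q and q=r and x=q and y=r] dom[OF q(1)] dom[OF that(1)] ab bad[OF q] bad[OF that] by auto
        qed
        have "A \<inter> B = {p, q}" using uniq p(1) q(1) by blast
        then have "card (A \<inter> B) = 2" using q by auto
        moreover have "K \<subseteq> {p}"
          using bad KAB by (auto simp: K_def)
        then have "card K \<le> 1" using card_mono[of "{p}" K] by auto
        moreover have "deg E a = 3" "deg E b = 3"
          using four_cycle_branch[where u=a and v=b and p=p and q=q and x=a and y=q] four_cycle_branch[where u=a and v=b and p=p and q=q and x=b and y=q] ab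
            dom[OF p(1)] dom[OF q(1)] bad[OF q] q(2) by auto
        ultimately show False using sum cA cB by auto
      qed
    qed
    \<comment> \<open>Equality holds throughout 4 \<le> |A| + |B| \<le> 2 + |K| + |A \<inter> B|
      \<le> 4.\<close>
    then have "card A = 2" "card B = 2" "card K = 1" "card (A \<inter> B) = 1"
      using sum dA KC by auto
    then obtain w where w: "K = {w}" by (auto simp: card_1_singleton_iff)
    then have wC: "w \<in> A \<inter> B" and nr: "\<not> R a w" "\<not> R b w" by (auto simp: K_def)
    then have C: "A \<inter> B = {w}"
      using \<open>card (A \<inter> B) = 1\<close> by (metis card_1_singletonE singletonD)
    obtain a' b' where a': "{y. E a y} = {w, a'}" "w \<noteq> a'" and b': "{y. E b y} = {w, b'}" "w \<noteq> b'"
      using deg_2_nbrs[of a w] deg_2_nbrs[of b w] \<open>card A = 2\<close> \<open>card B = 2\<close> cA cB dom[OF wC] by metis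
    have "a' \<noteq> b'" using C a' b' AN BN by auto
    moreover have "a' \<noteq> a" "a' \<noteq> b" "b' \<noteq> b" "b' \<noteq> a" using a' b' False ba irrefl by auto
    ultimately have "distinct [a, b, w, a', b']" using a' b' ab dom[OF wC] by auto
    then show ?thesis using a' b' nr by blast
  qed
qed

end

section \<open>Contractions of robust trigraphs\<close>

context robust_trigraph begin

text \<open>The set \<open>D\<close> is \<open>{b}\<close> if \<open>a\<close> and \<open>b\<close> are adjacent, and \<open>{b, w}\<close> if they have a common neighbour
  \<open>w\<close> of degree 2, which becomes pendant and is discarded.\<close>

lemma suppress:
  fixes a b a' b' :: 'a and D :: "'a set"
  assumes D: "D \<subseteq> V" "b \<in> D" and a: "a \<in> V" "a \<notin> D"
    and ends: "a' \<noteq> b'" "a' \<notin> insert a D" "b' \<notin> insert a D"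
    and inner: "\<And>d. d \<in> insert a D \<Longrightarrow> deg E d = 2"
      "\<And>d y. d \<in> insert a D \<Longrightarrow> E d y \<Longrightarrow> y \<in> insert a D \<union> {a', b'}"
    and a': "\<And>d. d \<in> insert a D \<Longrightarrow> E d a' \<longleftrightarrow> d = a"
    and b': "\<And>d. d \<in> insert a D \<Longrightarrow> E d b' \<longleftrightarrow> d = b"
    and E': "\<And>x y. E' x y \<longleftrightarrow> x \<in> V - D \<and> y \<in> V - D \<and>
      (if x = a then y \<in> {a', b'} else if y = a then x \<in> {a', b'} else E x y)"
    and R': "\<And>x y. R' x y \<longleftrightarrow> E' x y \<and> (x = a \<or> y = a \<or> R x y)"
    and red_deg': "\<And>x. x \<in> V - D \<Longrightarrow> deg R' x \<le> 2"
  shows "robust_trigraph (V - D) E' R'"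
proof -
  have aa': "E a a'" "E a' a" and bb': "E b b'" "E b' b" using a'[of a] b'[of b] D sym by auto
  have V': "a' \<in> V - D" "b' \<in> V - D" using aa' bb' edge_in ends by auto
  have ab: "a \<noteq> b" using a D by auto
  have naa: "{y. E' a y} = {a', b'}" unfolding E' using a V' by auto
  \<comment> \<open>The vertex \<open>b'\<close> trades its neighbour \<open>b\<close> for
    \<open>a\<close>, so its degree does not change.\<close>
  have nb: "{y. E' b' y} = insert a ({y. E b' y} - {b})"
  proof (intro set_eqI iffI)
    fix y assume "y \<in> {y. E' b' y}"
    then show "y \<in> insert a ({y. E b' y} - {b})" using ends D unfolding E' by (auto split: if_splits)
  next
    fix y assume y: "y \<in> insert a ({y. E b' y} - {b})"
    then have "y \<notin> D" using b'[of y] sym a by auto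
    then show "y \<in> {y. E' b' y}" using y V' a ends edge_in' b'[of y] sym ab unfolding E' by auto
  qed
  have no: "{y. E' v y} = {y. E v y}" if v: "v \<in> V - D" "v \<noteq> a" "v \<noteq> b'" for v
  proof (intro set_eqI iffI)
    fix y assume "y \<in> {y. E' v y}"
    then show "y \<in> {y. E v y}" using v ends aa' unfolding E' by (auto split: if_splits)
  next
    fix y assume "y \<in> {y. E v y}"
    then have y: "E v y" "E y v" "y \<in> V" using sym edge_in' by auto
    have "v = a' \<and> y = a" if "y \<in> insert a D"
      using inner(2)[OF that y(2)] v a'[OF that] y(2) by auto
    then show "y \<in> {y. E' v y}" using y v a unfolding E' by auto
  qed
  have deg': "deg E' v = deg E v" if "v \<in> V - D" for v
  proof -
    consider "v = a" | "v = b'" | "v \<noteq> a" "v \<noteq> b'" by blast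
    then show ?thesis
    proof cases
      case 1
      then show ?thesis using naa ends inner(1)[of a] by (simp add: deg_def)
    next
      case 2
      have "a \<notin> {y. E b' y}" using b'[of a] ab sym by auto
      moreover have "b \<in> {y. E b' y}" using bb' by simp
      moreover have "card {y. E b' y} > 0" using calculation finite_nbrs card_gt_0_iff by blast
      ultimately show ?thesis using finite_nbrs[of b'] 2
        by (simp add: deg_def nb card_insert_if card_Diff_singleton)
    next
      case 3
      then show ?thesis using no[OF that] by (simp add: deg_def)
    qed
  qed
  have core': "3 \<le> card {v \<in> non_isolated F'. deg E' v = 3} \<and> heavy E' R' F'"
    if F'E: "F' \<le> E'" and core': "core F'" for F'
  proof -
    \<comment> \<open>If \<open>F'\<close> passes through \<open>a\<close>, its two edges there are
      replaced by the whole old path from \<open>a'\<close> to \<open>b'\<close>, that is, by all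
      edges of \<open>E\<close> that meet \<open>insert a D\<close>. Otherwise \<open>F\<close>
      equals \<open>F'\<close>.\<close>
    define F where "F x y \<longleftrightarrow> F' x y \<and> x \<noteq> a \<and> y \<noteq> a \<or>
      (\<exists>z. F' a z) \<and> E x y \<and> (x \<in> insert a D \<or> y \<in> insert a D)" for x y
    have F'D: "E' x y" "x \<in> V - D" "y \<in> V - D" if "F' x y" for x y
      using that F'E E' by blast+
    have F'sym: "F' y x" if "F' x y" for x y using core' that unfolding core_def by blast
    have F'two: "\<exists>z. z \<noteq> y \<and> F' x z" if "F' x y" for x y
      using core' that unfolding core_def by blast
    have Fa: "F' a a' \<and> F' a b'" if az: "F' a z" for z
    proof -
      obtain z' where "z' \<noteq> z" "F' a z'" using F'two[OF az] by blast
      moreover have "z \<in> {a', b'}" "z' \<in> {a', b'}" using naa F'D(1) az calculation by blast+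
      ultimately show ?thesis using az by auto
    qed
    have F'E0: "E x y" if "F' x y" "x \<noteq> a" "y \<noteq> a" for x y
      using F'D(1)[OF that(1)] that unfolding E' by auto
    have FE: "F \<le> E" using F'E0 unfolding F_def by auto
    have F'xa: "x \<in> {a', b'}" if "F' x a" for x
      using F'D(1)[OF F'sym[OF that]] naa by blast
    have "core F" unfolding core_def
    proof (intro conjI allI impI)
      obtain x y where xy: "F' x y" using core' unfolding core_def by blast
      show "\<exists>x y. F x y"
      proof (cases "x = a \<or> y = a")
        case True
        then have "\<exists>z. F' a z" using xy F'sym by blast
        then show ?thesis using aa' unfolding F_def by blast
      qed (use xy in \<open>auto simp: F_def\<close>)
    next
      fix x y assume "F x y"
      then show "F y x" using F'sym sym unfolding F_def by blast
    next
      fix x y assume Fxy: "F x y"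
      then have Exy: "E x y" using FE by blast
      show "\<exists>z. z \<noteq> y \<and> F x z"
      proof (cases "x \<in> insert a D")
        case True
        then have act: "\<exists>z. F' a z" using Fxy F'D(2) unfolding F_def by blast
        obtain z where z: "{w. E x w} = {y, z}" "y \<noteq> z"
          using deg_2_nbrs[OF inner(1)[OF True] Exy] by blast
        then have "E x z" by blast
        then have "F x z" using act True unfolding F_def by blast
        then show ?thesis using z(2) by metis
      next
        case x: False
        show ?thesis
        proof (cases "y \<in> insert a D")
          case True
          then have act: "\<exists>z. F' a z" using Fxy F'D(3) unfolding F_def by blast
          have "x \<in> {a', b'}" using inner(2)[OF True] Exy sym x by blast
          then have "F' x a" using Fa act F'sym by blast
          then obtain z where z: "z \<noteq> a" "F' x z" using F'two by blast
          then have "F x z" using x unfolding F_def by blast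
          moreover have "z \<noteq> y" using z F'D(3) True by blast
          ultimately show ?thesis by metis
        next
          case False
          then have "F' x y" using Fxy x unfolding F_def by blast
          then obtain z where z: "z \<noteq> y" "F' x z" using F'two by blast
          \<comment> \<open>If the second edge of \<open>F'\<close> at \<open>x\<close> leads to
            \<open>a\<close>, its substitute is the end edge of the lifted path, from
            \<open>a'\<close> to \<open>a\<close> or from \<open>b'\<close> to
            \<open>b\<close>.\<close>
          show ?thesis
          proof (cases "z = a")
            case True
            then have "\<exists>z. F' a z" "x \<in> {a', b'}" using z F'sym F'xa by blast+
            then have "F x a \<or> F x b" using aa' bb' D unfolding F_def by auto
            then show ?thesis using False D by (metis insertCI)
          next
            case False
            then have "F x z" using z x unfolding F_def by blast
            then show ?thesis using z(1) by metis
          qed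
        qed
      qed
    qed
    note br = core_branch[OF FE this] and hv = core_heavy[OF FE this]
    \<comment> \<open>The vertices that the lift adds all have degree 2.\<close>
    have "{v \<in> non_isolated F. deg E v = 3} \<subseteq> {v \<in> non_isolated F'. deg E' v = 3}"
    proof
      fix v assume "v \<in> {v \<in> non_isolated F. deg E v = 3}"
      then obtain y where v: "F v y" "deg E v = 3" unfolding non_isolated_def by blast
      then have vD: "v \<notin> insert a D" using inner(1) by fastforce
      have "\<exists>z. F' v z"
      proof (cases "F' v y")
        case False
        then have y: "y \<in> insert a D" "\<exists>z. F' a z" "E v y" using v vD unfolding F_def by auto
        then have "v \<in> {a', b'}" using inner(2)[OF y(1)] sym vD by blast
        then show ?thesis using Fa y(2) F'sym by blast
      qed blast
      then show "v \<in> {v \<in> non_isolated F'. deg E' v = 3}"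
        using v(2) deg' F'D(2) unfolding non_isolated_def by force
    qed
    moreover have "finite (non_isolated F')"
      by (rule finite_subset[OF _ finite_V]) (use F'D in \<open>auto simp: non_isolated_def\<close>)
    ultimately have "card {v \<in> non_isolated F. deg E v = 3} \<le> card {v \<in> non_isolated F'. deg E' v = 3}"
      by (intro card_mono) auto
    moreover have "heavy E' R' F'"
    \<comment> \<open>A core through \<open>a\<close> has a red turn there, at a vertex of degree 2.
      Any other core was a core before, with the same red turns and degrees.\<close>
    proof (cases "\<exists>z. F' a z")
      case True
      then have "F' a a'" "F' a b'" using Fa by blast+
      moreover then have "R' a a'" "R' a b'" using R' F'D(1) by blast+
      ultimately have "a \<in> red_turns F' R'" using ends unfolding red_turns_def by blast
      moreover have "deg E' a = 2" using deg'[of a] inner(1)[of a] a by simp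
      ultimately show ?thesis unfolding heavy_def by blast
    next
      case False
      then have ne: "x \<noteq> a" "y \<noteq> a" if "F' x y" for x y using F'sym that by metis+
      then have "F = F'" using False unfolding F_def by (intro ext) auto
      moreover have "red_turns F' R' = red_turns F' R"
      proof -
        have "F' x y \<and> R' x y \<longleftrightarrow> F' x y \<and> R x y" for x y
          using ne[of x y] F'D(1)[of x y] R'[of x y] by auto
        then show ?thesis unfolding red_turns_def by metis
      qed
      moreover have "v \<in> V - D" if "v \<in> red_turns F' R" for v
        using that F'D(2) unfolding red_turns_def by blast
      ultimately show ?thesis using hv deg' unfolding heavy_def by auto
    qed
    ultimately show ?thesis using br by linarith
  qed
  show ?thesis
  proof
    show "finite (V - D)" using finite_V by simp
    show "V - D \<noteq> {}" using a by blast
    show "E' y x" if "E' x y" for x y using that sym unfolding E' by (auto split: if_splits)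
    show "\<not> E' x x" for x using irrefl ends unfolding E' by auto
    show "x \<in> V - D" if "E' x y" for x y using that unfolding E' by blast
    show "R' y x" if "R' x y" for x y
      using that sym red_sym unfolding R' E' by (auto split: if_splits)
    show "E' x y" if "R' x y" for x y using that unfolding R' by blast
    show "deg E' x = 2 \<or> deg E' x = 3" if "x \<in> V - D" for x using deg' deg_2_3 that by auto
    show "deg R' x \<le> 2" if "x \<in> V - D" for x using red_deg' that by blast
    show "3 \<le> card {v \<in> non_isolated F. deg E' v = 3}" if "F \<le> E'" "core F" for F
      using core' that by blast
    show "heavy E' R' F" if "F \<le> E'" "core F" for F
      using core' that by blast
  qed
qed

text \<open>The branch vertex \<open>w\<close> loses its role to the contracted vertex, which keeps the name \<open>a\<close>. A core
  turning at \<open>w\<close> loses two vertices, but gains a red turn at \<open>a\<close>.\<close>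

lemma shift_branch:
  fixes a b w a' b' :: 'a
  assumes V: "a \<in> V" "b \<in> V" and dist: "distinct [a, b, w, a', b']"
    and na: "{y. E a y} = {w, a'}" and nb: "{y. E b y} = {w, b'}"
    and black: "\<not> R a w" "\<not> R b w" and w3: "deg E w = 3"
    and E': "\<And>x y. E' x y \<longleftrightarrow> x \<in> V - {b} \<and> y \<in> V - {b} \<and>
      (if x = a then y \<in> {w, a', b'} else if y = a then x \<in> {w, a', b'} else E x y)"
    and R': "\<And>x y. R' x y \<longleftrightarrow> E' x y \<and> (if x = a then y \<noteq> w else if y = a then x \<noteq> w else R x y)"
    and red_deg': "\<And>x. x \<in> V - {b} \<Longrightarrow> deg R' x \<le> 2"
  shows "robust_trigraph (V - {b}) E' R'"
proof -
  have d: "a \<noteq> b" "a \<noteq> w" "a \<noteq> a'" "a \<noteq> b'" "b \<noteq> w" "b \<noteq> a'" "b \<noteq> b'" "w \<noteq> a'" "w \<noteq> b'" "a' \<noteq> b'"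
    using dist by auto
  have Ea: "E a y \<longleftrightarrow> y = w \<or> y = a'" "E y a \<longleftrightarrow> y = w \<or> y = a'" for y
    using na sym by (metis insert_iff mem_Collect_eq singletonD)+
  have Eb: "E b y \<longleftrightarrow> y = w \<or> y = b'" "E y b \<longleftrightarrow> y = w \<or> y = b'" for y
    using nb sym by (metis insert_iff mem_Collect_eq singletonD)+
  have V': "w \<in> V" "a' \<in> V" "b' \<in> V" 
    using edge_in[of w a] edge_in[of a' a] edge_in[of b' b] Ea Eb by simp_all
  obtain z where nw: "{y. E w y} = {a, b, z}" "z \<noteq> a" "z \<noteq> b"
  proof -
    have "card ({y. E w y} - {a, b}) = 1"
      using w3 Ea Eb finite_nbrs[of w] d unfolding deg_def
      by (subst card_Diff_subset) auto
    then obtain z where "{y. E w y} - {a, b} = {z}" by (auto simp: card_1_singleton_iff)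
    moreover have "E w a" "E w b" using Ea Eb by auto
    ultimately show ?thesis using that[of z] by blast
  qed
  then have Ew: "E w y \<longleftrightarrow> y = a \<or> y = b \<or> y = z" "E y w \<longleftrightarrow> y = a \<or> y = b \<or> y = z" for y
    using sym by (metis insert_iff mem_Collect_eq singletonD)+
  have zw: "z \<noteq> w" "z \<in> V" 
    using Ew(2)[of z] irrefl[of z] edge_in[of z w] by auto
  have E'a: "E' a y \<longleftrightarrow> y = w \<or> y = a' \<or> y = b'" "E' y a \<longleftrightarrow> y = w \<or> y = a' \<or> y = b'" for y
    unfolding E' using V V' d by auto
  have E'w: "E' w y \<longleftrightarrow> y = a \<or> y = z" for y
    unfolding E' using V V' d Ew nw zw by auto
  have E'o: "E' x y \<longleftrightarrow> E x y" if "x \<noteq> a" "y \<noteq> a" "x \<noteq> b" "y \<noteq> b" for x y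
    unfolding E' using that edge_in edge_in' by auto
  have E'b: "\<not> E' b y" "\<not> E' y b" for y unfolding E' by auto
  have "{y. E' a y} = {w, a', b'}" "{y. E' w y} = {a, z}" using E'a E'w by auto
  then have deg'a: "deg E' a = 3" and deg'w: "deg E' w = 2"
    unfolding deg_def using d nw(2) by auto
  have deg': "deg E' v = deg E v" if v: "v \<noteq> a" "v \<noteq> b" "v \<noteq> w" for v
  proof (cases "v = b'")
    case True
    have "{y. E' v y} = insert a ({y. E v y} - {b})"
    proof (intro set_eqI)
      fix y
      show "y \<in> {y. E' v y} \<longleftrightarrow> y \<in> insert a ({y. E v y} - {b})"
        using True v d E'a E'b E'o[of v y] by (cases "y = a"; cases "y = b") auto
    qed
    moreover have "a \<notin> {y. E v y}" "b \<in> {y. E v y}" using True Ea Eb d by auto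
    moreover have "card {y. E v y} > 0" using calculation finite_nbrs card_gt_0_iff by blast
    ultimately show ?thesis using finite_nbrs[of v]
      by (simp add: deg_def card_insert_if card_Diff_singleton)
  next
    case False
    have "{y. E' v y} = {y. E v y}"
    proof (intro set_eqI)
      fix y
      show "y \<in> {y. E' v y} \<longleftrightarrow> y \<in> {y. E v y}"
        using False v E'a E'b E'o[of v y] Ea Eb by (cases "y = a"; cases "y = b") auto
    qed
    then show ?thesis by (simp add: deg_def)
  qed
  have degab: "deg E a = 2" "deg E b = 2" unfolding deg_def na nb using d by auto
  have core': "3 \<le> card {v \<in> non_isolated F'. deg E' v = 3} \<and> heavy E' R' F'"
    if F'E: "F' \<le> E'" and core': "core F'" for F'
  proof -
    \<comment> \<open>The lift undoes the merging of \<open>a\<close> and \<open>b\<close>: the edge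
      from \<open>a\<close> to \<open>a'\<close> becomes the path \<open>a'\<close>,
      \<open>a\<close>, \<open>w\<close>, and the edge from \<open>a\<close> to \<open>b'\<close>
      becomes the path \<open>b'\<close>, \<open>b\<close>, \<open>w\<close>. The edge of
      \<open>F'\<close> between \<open>a\<close> and \<open>w\<close> needs no separate image, as
      \<open>w\<close> is reached by these paths.\<close>
    define F where "F x y \<longleftrightarrow> F' x y \<and> x \<noteq> a \<and> y \<noteq> a \<or>
      F' a a' \<and> {x, y} \<in> {{a, a'}, {a, w}} \<or> F' a b' \<and> {x, y} \<in> {{b, b'}, {b, w}}" for x y
    have F'sym: "F' y x" if "F' x y" for x y using core' that unfolding core_def by blast
    have F'two: "\<exists>z. z \<noteq> y \<and> F' x z" if "F' x y" for x y
      using core' that unfolding core_def by blast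
    have F'D: "E' x y" "x \<in> V" "y \<in> V" "x \<noteq> b" "y \<noteq> b" if "F' x y" for x y
      using that F'E E' by blast+
    have F'a: "y = w \<or> y = a' \<or> y = b'" if "F' a y" for y using F'D(1)[OF that] E'a by blast
    have F'w: "y = a \<or> y = z" if "F' w y" for y using F'D(1)[OF that] E'w by blast
    have Fsym: "F y x" if "F x y" for x y
      using that F'sym unfolding F_def by (simp add: insert_commute) blast
    have Fw: "F' w a \<and> F' w z" if "F' w y" for y
      using F'two[OF that] F'w[OF that] that F'w by blast
    have Fa1: "F' a a' \<or> F' a b'" if "F' a y" for y
      using F'two[OF that] F'a[OF that] that F'a by blast
    have Fa2: "F' a a' \<and> F' a b'" if "F' a y" "\<not> F' a w" for y
      using F'two[OF that(1)] F'a[OF that(1)] that F'a by blast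
    have Faa: "F a y \<longleftrightarrow> F' a a' \<and> (y = a' \<or> y = w)" for y
      using d unfolding F_def by (auto simp: doubleton_eq_iff)
    have Fbb: "F b y \<longleftrightarrow> F' a b' \<and> (y = b' \<or> y = w)" for y
      using d F'D(4) unfolding F_def by (auto simp: doubleton_eq_iff)
    have Fww: "F w y \<longleftrightarrow> F' w z \<and> y = z \<or> F' a a' \<and> y = a \<or> F' a b' \<and> y = b" for y
      using d F'w nw zw unfolding F_def by (auto simp: doubleton_eq_iff)
    have Foo: "F x y \<longleftrightarrow> F' x y \<and> y \<noteq> a \<or> F' a a' \<and> x = a' \<and> y = a \<or> F' a b' \<and> x = b' \<and> y = b"
      if "x \<noteq> a" "x \<noteq> b" "x \<noteq> w" for x y
      using that d unfolding F_def by (auto simp: doubleton_eq_iff)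
    have FE: "F \<le> E"
    proof (intro predicate2I)
      fix x y assume F: "F x y"
      consider "x = a" | "x = b" | "x = w" | "x \<noteq> a" "x \<noteq> b" "x \<noteq> w" by blast
      then show "E x y"
      proof cases
        case 1 then show ?thesis using F Faa Ea by blast
      next
        case 2 then show ?thesis using F Fbb Eb by blast
      next
        case 3 then show ?thesis using F Fww Ew by blast
      next
        case 4 then show ?thesis using F Foo[OF 4] Ea Eb E'o F'D by metis
      qed
    qed
    have "core F" unfolding core_def
    proof (intro conjI allI impI)
      obtain x y where xy: "F' x y" using core' unfolding core_def by blast
      show "\<exists>x y. F x y"
      proof (cases "x = a \<or> y = a")
        case True
        then have "F' a a' \<or> F' a b'" using xy F'sym Fa1 by blast
        then show ?thesis using Faa Fbb by blast
      qed (use xy in \<open>auto simp: F_def\<close>)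
    next
      show "F y x" if "F x y" for x y using Fsym[OF that] .
    next
      fix x y assume F: "F x y"
      consider "x = a" | "x = b" | "x = w" | "x \<noteq> a" "x \<noteq> b" "x \<noteq> w" by blast
      then show "\<exists>z. z \<noteq> y \<and> F x z"
      proof cases
        case 1 then show ?thesis using F Faa d by metis
      next
        case 2 then show ?thesis using F Fbb d by metis
      next
        \<comment> \<open>If \<open>F'\<close> contains the edge from \<open>w\<close> to
          \<open>z\<close>, it also contains the one from \<open>w\<close> to \<open>a\<close> and
          therefore uses \<open>a'\<close> or \<open>b'\<close>, which gives a second edge of the
          lift at \<open>w\<close>. Otherwise it uses both, and the lift turns at \<open>w\<close>
          from \<open>a\<close> to \<open>b\<close>.\<close>
        case 3
        show ?thesis
        proof (cases "F' w z")
          case True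
          then have "F' a a' \<or> F' a b'" using Fw F'sym Fa1 by blast
          then have "F w z" "F w a \<or> F w b" using True Fww by blast+
          then show ?thesis using 3 nw(2,3) by metis
        next
          case False
          then have "\<not> F' a w" using Fw F'sym by blast
          then have "F' a a' \<and> F' a b'" using F 3 False Fww Fa2 by blast
          then have "F w a" "F w b" using Fww by blast+
          then show ?thesis using 3 d(1) by metis
        qed
      next
        case 4
        note Fx = Foo[OF 4]
        have F'x: "F' x y' \<Longrightarrow> y' \<noteq> a \<Longrightarrow> F x y'" for y' using Fx by blast
        have F'xa: "F' x a \<Longrightarrow> x = a' \<and> F x a \<or> x = b' \<and> F x b" using F'a F'sym 4 Fx by blast
        show ?thesis
        proof (cases "F' x y \<and> y \<noteq> a")
          case True
          then obtain y' where y': "y' \<noteq> y" "F' x y'" using F'two by blast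
          show ?thesis
          proof (cases "y' = a")
            case True
            then show ?thesis using y' F'xa \<open>F' x y \<and> y \<noteq> a\<close> F'D(5) by metis
          qed (use y' F'x in metis)
        next
          case False
          then have "F' a x" "y = a \<or> y = b" using F Fx by blast+
          then obtain y' where "y' \<noteq> a" "F' x y'" using F'two F'sym by blast
          then show ?thesis using F'x F'D(5) \<open>y = a \<or> y = b\<close> by metis
        qed
      qed
    qed
    note br = core_branch[OF FE this] and hv = core_heavy[OF FE this]
    have fin': "finite (non_isolated F')" "finite (red_turns F' R')"
      by (rule finite_subset[OF _ finite_V]; use F'D in \<open>auto simp: non_isolated_def red_turns_def\<close>)+
    have fo: "v \<in> non_isolated F'" if "v \<in> non_isolated F" "v \<noteq> a" "v \<noteq> b" "v \<noteq> w" for v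
      using that Foo[OF that(2-)] F'sym unfolding non_isolated_def by blast
    have fw: "a \<in> non_isolated F'" if "w \<in> non_isolated F"
      using that Fww Fw F'sym unfolding non_isolated_def by blast
    \<comment> \<open>Degree 3 moves from \<open>w\<close> to \<open>a\<close>. Since
      \<open>a\<close> had degree 2 in \<open>E\<close>, this renaming is injective on the vertices
      of degree 3.\<close>
    define f where "f v = (if v = w then a else v)" for v
    have "card {v \<in> non_isolated F. deg E v = 3} \<le> card {v \<in> non_isolated F'. deg E' v = 3}"
    proof (rule card_inj_on_le[of f])
      show "inj_on f {v \<in> non_isolated F. deg E v = 3}"
        using degab by (auto simp: inj_on_def f_def)
      show "f ` {v \<in> non_isolated F. deg E v = 3} \<subseteq> {v \<in> non_isolated F'. deg E' v = 3}"
      proof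
        fix x assume "x \<in> f ` {v \<in> non_isolated F. deg E v = 3}"
        then obtain v where v: "x = f v" "v \<in> non_isolated F" "deg E v = 3" by blast
        then have "v \<noteq> a" "v \<noteq> b" using degab by auto
        then show "x \<in> {v \<in> non_isolated F'. deg E' v = 3}"
          using v fo[of v] fw deg'a deg'[of v] by (auto simp: f_def)
      qed
    qed (use fin' in simp)
    moreover have "heavy E' R' F'"
    proof -
      \<comment> \<open>One of the two edges at \<open>a\<close> is black, likewise at
        \<open>b\<close>, and two of the three at \<open>w\<close>. So no red turn of the lift lies
        where degrees change, and none can be lost.\<close>
      have nt: "v \<noteq> a \<and> v \<noteq> b \<and> v \<noteq> w" if turn: "v \<in> red_turns F R" for v
      proof -
        obtain y1 y2 where y: "y1 \<noteq> y2" "F v y1" "R v y1" "F v y2" "R v y2"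
          using turn unfolding red_turns_def by blast
        have "v \<noteq> a" using y Faa black(1) by metis
        moreover have "v \<noteq> b" using y Fbb black(2) by metis
        moreover have "v \<noteq> w" using y Fww black red_sym by metis
        ultimately show ?thesis by simp
      qed
      have sub: "v \<in> red_turns F' R'" if turn: "v \<in> red_turns F R" for v
      proof -
        obtain y1 y2 where y: "y1 \<noteq> y2" "F v y1" "R v y1" "F v y2" "R v y2"
          using turn unfolding red_turns_def by blast
        note v = nt[OF turn]
        \<comment> \<open>The neighbour \<open>b\<close> of \<open>b'\<close> has become
          \<open>a\<close>; the new edge is red because \<open>b'\<close> is not adjacent to
          \<open>a\<close> in \<open>E\<close>.\<close>
        define g where "g y = (if y = b then a else y)" for y
        have "F' v (g y) \<and> R' v (g y)" if "F v y" "R v y" for y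
          using that Foo[of v y] v F'sym[of a v] F'D(1)[of v y] F'D(1)[of v a] F'D(5)[of v y] d
          unfolding g_def R' by auto
        moreover have "g y1 \<noteq> g y2"
          using y Foo[of v y1] Foo[of v y2] v d F'D(5)[of v] unfolding g_def by auto
        ultimately show ?thesis using y unfolding red_turns_def by blast
      qed
      consider "\<exists>v\<in>red_turns F R. deg E v = 2" | "7 \<le> card (non_isolated F) + 2 * card (red_turns F R)"
        using hv unfolding heavy_def by blast
      then show ?thesis
      proof cases
        case 1
        then obtain v where "v \<in> red_turns F R" "deg E v = 2" by blast
        then show ?thesis using sub nt deg' unfolding heavy_def by metis
      next
        case 2
        have "card (non_isolated F) + 2 * card (red_turns F R) \<le>
          card (non_isolated F') + 2 * card (red_turns F' R')"
        \<comment> \<open>If both edges are used, the lift can exceed the core by the vertices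
          \<open>b\<close> and \<open>w\<close>. Both edges are red after the contraction, so
          \<open>a\<close> is a new red turn and its weight 2 makes up for them.\<close>
        proof (cases "F' a a' \<and> F' a b'")
          case True
          then have "a \<in> red_turns F' R'"
            using d F'D(1) unfolding red_turns_def R' by auto
          then have "insert a (red_turns F R) \<subseteq> red_turns F' R'" using sub by blast
          then have "card (insert a (red_turns F R)) \<le> card (red_turns F' R')"
            using fin' by (intro card_mono)
          moreover have "card (insert a (red_turns F R)) = Suc (card (red_turns F R))"
            using nt finite_red_turns[OF FE] by (intro card_insert_disjoint) auto
          moreover have "card (non_isolated F) \<le> card (non_isolated F' \<union> {b, w})"
          proof (rule card_mono)
            show "non_isolated F \<subseteq> non_isolated F' \<union> {b, w}"
              using fo True by (auto simp: non_isolated_def)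
          qed (use fin' in simp)
          moreover have "card (non_isolated F' \<union> {b, w}) \<le> card (non_isolated F') + card {b, w}"
            by (rule card_Un_le)
          ultimately show ?thesis using d by simp
        next
          case False
          have rt: "card (red_turns F R) \<le> card (red_turns F' R')"
            using sub fin' by (intro card_mono) auto
          \<comment> \<open>At most one of the two edges is used, so the lift contains at most one
            of \<open>a\<close> and \<open>b\<close>, and renaming \<open>b\<close> to
            \<open>a\<close> loses no vertex.\<close>
          define g where "g v = (if v = b then a else v)" for v
          have "card (non_isolated F) \<le> card (non_isolated F')"
          proof (rule card_inj_on_le[of g])
            have "\<not> (a \<in> non_isolated F \<and> b \<in> non_isolated F)"
              using False Faa Fbb unfolding non_isolated_def by blast
            then show "inj_on g (non_isolated F)" by (auto simp: inj_on_def g_def)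
            show "g ` non_isolated F \<subseteq> non_isolated F'"
            proof
              fix x assume "x \<in> g ` non_isolated F"
              then obtain v where v: "x = g v" "v \<in> non_isolated F" by blast
              have "a \<in> non_isolated F'" if "v = a \<or> v = b"
                using that v Faa Fbb unfolding non_isolated_def by auto
              moreover have "w \<in> non_isolated F'" if "v = w"
              proof -
                have "\<exists>y. F w y" using that v unfolding non_isolated_def by blast
                then consider "F' w z" | "F' a a' \<or> F' a b'" using Fww by blast
                then have "F' w z \<or> F' a w" by cases (use Fa2 False in blast)+
                then show ?thesis using F'sym unfolding non_isolated_def by blast
              qed
              ultimately show "x \<in> non_isolated F'" using v fo[of v] d by (auto simp: g_def)
            qed
          qed (use fin' in simp)
          then show ?thesis using rt by simp
        qed
        then show ?thesis using 2 unfolding heavy_def by linarith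
      qed
    qed
    ultimately show ?thesis using br by linarith
  qed
  show ?thesis
  proof
    show "finite (V - {b})" using finite_V by simp
    show "V - {b} \<noteq> {}" using V d by blast
    show "E' y x" if "E' x y" for x y using that sym unfolding E' by (auto split: if_splits)
    show "\<not> E' x x" for x using irrefl d unfolding E' by auto
    show "x \<in> V - {b}" if "E' x y" for x y using that unfolding E' by blast
    show "R' y x" if "R' x y" for x y
      using that sym red_sym unfolding R' E' by (auto split: if_splits)
    show "E' x y" if "R' x y" for x y using that unfolding R' by blast
    show "deg E' x = 2 \<or> deg E' x = 3" if "x \<in> V - {b}" for x
      using deg' deg'a deg'w deg_2_3 that by (metis DiffE singletonI)
    show "deg R' x \<le> 2" if "x \<in> V - {b}" for x using red_deg' that by blast
    show "3 \<le> card {v \<in> non_isolated F. deg E' v = 3}" if "F \<le> E'" "core F" for F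
      using core' that by blast
    show "heavy E' R' F" if "F \<le> E'" "core F" for F
      using core' that by blast
  qed
qed

end

text \<open>The contracted vertex keeps the name \<open>a\<close> and \<open>b\<close> disappears;
  the actual new vertex enters only through the map into the trigraph.\<close>

definition contract_edge :: "'a \<Rightarrow> 'a \<Rightarrow> ('a \<Rightarrow> 'a \<Rightarrow> bool) \<Rightarrow> 'a \<Rightarrow> 'a \<Rightarrow> bool" where
  "contract_edge a b E x y \<longleftrightarrow> x \<noteq> b \<and> y \<noteq> b \<and> x \<noteq> y \<and>
     (E x y \<or> x = a \<and> E b y \<or> y = a \<and> E x b)"

definition contract_red ::
  "'a \<Rightarrow> 'a \<Rightarrow> ('a \<Rightarrow> 'a \<Rightarrow> bool) \<Rightarrow> ('a \<Rightarrow> 'a \<Rightarrow> bool) \<Rightarrow> 'a \<Rightarrow> 'a \<Rightarrow> bool" where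
  "contract_red a b E R x y \<longleftrightarrow> contract_edge a b E x y \<and>
     (if x = a then \<not> (E a y \<and> \<not> R a y \<and> E b y \<and> \<not> R b y)
      else if y = a then \<not> (E x a \<and> \<not> R x a \<and> E x b \<and> \<not> R x b)
      else R x y)"

definition restrict_rel :: "'a set \<Rightarrow> ('a \<Rightarrow> 'a \<Rightarrow> bool) \<Rightarrow> 'a \<Rightarrow> 'a \<Rightarrow> bool" where
  "restrict_rel W A x y \<longleftrightarrow> x \<in> W \<and> y \<in> W \<and> A x y"

context robust_trigraph begin

text \<open>The bound \<open>red\<close> at \<open>a\<close> is what
  \<open>contractible_pair\<close> asks for. Adjacent vertices, or a common neighbour
  \<open>w\<close> of degree 2, lead to \<open>suppress\<close>; a common neighbour of degree 3
  leads to \<open>shift_branch\<close>. The set \<open>W\<close> allows \<open>w\<close> to be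
  dropped when it becomes pendant.\<close>

lemma contract_robust:
  assumes a: "a \<in> V" and b: "b \<in> V" and ab: "a \<noteq> b"
    and red: "\<And>x. x \<in> V - {b} \<Longrightarrow> deg (contract_red a b E R) x \<le> 2"
  shows "\<exists>W \<subseteq> V - {b}. robust_trigraph W (restrict_rel W (contract_edge a b E))
    (restrict_rel W (contract_red a b E R))"
proof -
  have red_le: "deg (restrict_rel W (contract_red a b E R)) x \<le> 2" if "x \<in> W" "W \<subseteq> V - {b}" for W x
  proof -
    have "{y. contract_red a b E R x y} \<subseteq> insert a V"
      using edge_in' unfolding contract_red_def contract_edge_def by auto
    then have "finite {y. contract_red a b E R x y}" using finite_V finite_subset by blast
    then have "deg (restrict_rel W (contract_red a b E R)) x \<le> deg (contract_red a b E R) x"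
      unfolding deg_def restrict_rel_def by (intro card_mono) auto
    then show ?thesis using red that by fastforce
  qed
  have "{y. y \<noteq> a \<and> y \<noteq> b \<and> (E a y \<or> E b y) \<and> \<not> (E a y \<and> \<not> R a y \<and> E b y \<and> \<not> R b y)} =
    {y. contract_red a b E R a y}"
    using ab irrefl unfolding contract_red_def contract_edge_def by auto
  then have "card {y. y \<noteq> a \<and> y \<noteq> b \<and> (E a y \<or> E b y) \<and>
      \<not> (E a y \<and> \<not> R a y \<and> E b y \<and> \<not> R b y)} \<le> 2"
    using red[of a] a ab by (simp add: deg_def)
  from contractible_pair[OF a b ab this] show ?thesis
  proof (elim disjE exE conjE)
    fix a' b' assume na: "{y. E a y} = {b, a'}" and nb: "{y. E b y} = {a, b'}"
      and dist: "distinct [a, b, a', b']"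
    have Ea: "E a y \<longleftrightarrow> y = b \<or> y = a'" "E y a \<longleftrightarrow> y = b \<or> y = a'" for y
      using na sym by (metis insert_iff mem_Collect_eq singletonD)+
    have Eb: "E b y \<longleftrightarrow> y = a \<or> y = b'" "E y b \<longleftrightarrow> y = a \<or> y = b'" for y
      using nb sym by (metis insert_iff mem_Collect_eq singletonD)+
    have "robust_trigraph (V - {b}) (restrict_rel (V - {b}) (contract_edge a b E))
      (restrict_rel (V - {b}) (contract_red a b E R))"
    proof (rule suppress[of "{b}" b a a' b'])
      show "deg E d = 2" if "d \<in> insert a {b}" for d
        using that na nb dist by (auto simp: deg_def)
      fix x y
      show "restrict_rel (V - {b}) (contract_edge a b E) x y \<longleftrightarrow>
        x \<in> V - {b} \<and> y \<in> V - {b} \<and>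
        (if x = a then y \<in> {a', b'} else if y = a then x \<in> {a', b'} else E x y)"
        using dist irrefl[of x] Ea Eb unfolding restrict_rel_def contract_edge_def
        by (cases "x = a"; cases "y = a") auto
      show "restrict_rel (V - {b}) (contract_red a b E R) x y \<longleftrightarrow>
        restrict_rel (V - {b}) (contract_edge a b E) x y \<and> (x = a \<or> y = a \<or> R x y)"
        using dist Ea Eb unfolding restrict_rel_def contract_edge_def contract_red_def
        by (cases "x = a"; cases "y = a") auto
    qed (use a b ab dist Ea Eb red_le in auto)
    then show ?thesis by blast
  next
    fix w a' b' assume na: "{y. E a y} = {w, a'}" and nb: "{y. E b y} = {w, b'}"
      and dist: "distinct [a, b, w, a', b']" and black: "\<not> R a w" "\<not> R b w"
    have Ea: "E a y \<longleftrightarrow> y = w \<or> y = a'" "E y a \<longleftrightarrow> y = w \<or> y = a'" for y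
      using na sym by (metis insert_iff mem_Collect_eq singletonD)+
    have Eb: "E b y \<longleftrightarrow> y = w \<or> y = b'" "E y b \<longleftrightarrow> y = w \<or> y = b'" for y
      using nb sym by (metis insert_iff mem_Collect_eq singletonD)+
    have wV: "w \<in> V" using Ea(1)[of w] edge_in'[of a w] by blast
    have deg2: "deg E a = 2" "deg E b = 2" using na nb dist by (auto simp: deg_def)
    show ?thesis
    proof (cases "deg E w = 2")
      case True
      have Ewa: "E w a" "E w b" using Ea Eb by auto
      obtain z where z: "{y. E w y} = {a, z}" using deg_2_nbrs[OF True Ewa(1)] by blast
      then have "z = b" using Ewa ab by (metis insert_iff mem_Collect_eq singletonD)
      then have Ew: "E w y \<longleftrightarrow> y = a \<or> y = b" "E y w \<longleftrightarrow> y = a \<or> y = b" for y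
        using z sym by (metis insert_iff mem_Collect_eq singletonD)+
      let ?W = "V - {b, w}"
      have "robust_trigraph ?W (restrict_rel ?W (contract_edge a b E))
        (restrict_rel ?W (contract_red a b E R))"
      proof (rule suppress[of "{b, w}" b a a' b'])
        show "deg E d = 2" if "d \<in> insert a {b, w}" for d
          using that deg2 True by auto
        fix x y
        show "restrict_rel ?W (contract_edge a b E) x y \<longleftrightarrow> x \<in> ?W \<and> y \<in> ?W \<and>
          (if x = a then y \<in> {a', b'} else if y = a then x \<in> {a', b'} else E x y)"
          using dist irrefl[of x] Ea Eb unfolding restrict_rel_def contract_edge_def
          by (cases "x = a"; cases "y = a") auto
        show "restrict_rel ?W (contract_red a b E R) x y \<longleftrightarrow>
          restrict_rel ?W (contract_edge a b E) x y \<and> (x = a \<or> y = a \<or> R x y)"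
          using dist Ea Eb unfolding restrict_rel_def contract_edge_def contract_red_def
          by (cases "x = a"; cases "y = a") auto
        show "E d a' \<longleftrightarrow> d = a" if "d \<in> insert a {b, w}" for d
          using that Ea(1)[of a'] Eb(1)[of a'] Ew(1)[of a'] dist by auto
        show "E d b' \<longleftrightarrow> d = b" if "d \<in> insert a {b, w}" for d
          using that Ea(1)[of b'] Eb(1)[of b'] Ew(1)[of b'] dist by auto
        show "c \<in> insert a {b, w} \<union> {a', b'}" if "d \<in> insert a {b, w}" "E d c" for d c
          using that Ea(1)[of c] Eb(1)[of c] Ew(1)[of c] by auto
        show "deg (restrict_rel ?W (contract_red a b E R)) d \<le> 2" if "d \<in> ?W" for d
          using that by (rule red_le) blast
      qed (use a b ab wV dist in auto)
      then show ?thesis by (intro exI[of _ ?W]) auto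
    next
      case False
      then have w3: "deg E w = 3" using deg_2_3[OF wV] by blast
      let ?W = "V - {b}"
      have "robust_trigraph ?W (restrict_rel ?W (contract_edge a b E))
        (restrict_rel ?W (contract_red a b E R))"
      proof (rule shift_branch[OF a b dist na nb black w3])
        have bl: "\<not> R w a" "\<not> R w b" using black red_sym by blast+
        fix x y
        show "restrict_rel ?W (contract_edge a b E) x y \<longleftrightarrow> x \<in> ?W \<and> y \<in> ?W \<and>
          (if x = a then y \<in> {w, a', b'} else if y = a then x \<in> {w, a', b'} else E x y)"
          using dist irrefl[of x] Ea Eb unfolding restrict_rel_def contract_edge_def
          by (cases "x = a"; cases "y = a") auto
        show "restrict_rel ?W (contract_red a b E R) x y \<longleftrightarrow>
          restrict_rel ?W (contract_edge a b E) x y \<and>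
          (if x = a then y \<noteq> w else if y = a then x \<noteq> w else R x y)"
          using dist Ea Eb black bl unfolding restrict_rel_def contract_edge_def contract_red_def
          by (cases "x = a"; cases "y = a") auto
      qed (use red_le in auto)
      then show ?thesis by blast
    qed
  qed
qed

end

text \<open>Red edges of \<open>H\<close> put no constraint on the modelled pair, so that the vertices of \<open>H\<close> outside the
  image of \<open>f\<close> may be contracted freely.\<close>

definition models :: "'a trigraph \<Rightarrow> 'b set \<Rightarrow> ('b \<Rightarrow> 'b \<Rightarrow> bool) \<Rightarrow> ('b \<Rightarrow> 'b \<Rightarrow> bool) \<Rightarrow>
    ('b \<Rightarrow> 'a) \<Rightarrow> bool" where
  "models H V E R f \<longleftrightarrow> inj_on f V \<and> f ` V \<subseteq> tverts H \<and>
     (\<forall>x\<in>V. \<forall>y\<in>V. x \<noteq> y \<longrightarrow> ({f x, f y} \<in> black H \<longrightarrow> E x y \<and> \<not> R x y) \<and>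
       (E x y \<longrightarrow> {f x, f y} \<in> black H \<union> red H))"

section \<open>Tracking a robust pair through contractions of a trigraph\<close>

lemma contract_commute: "contract H u v x = contract H v u x"
  unfolding contract_def by (simp add: insert_commute) blast

context
  fixes H :: "'a trigraph" and u v x :: 'a
  assumes H: "trigraph H" and x: "x \<notin> tverts H - {u, v}"
begin

lemma contract_old:
  assumes "y \<in> tverts H - {u, v}" "z \<in> tverts H - {u, v}"
  shows "{y, z} \<in> black (contract H u v x) \<longleftrightarrow> {y, z} \<in> black H"
    "{y, z} \<in> red (contract H u v x) \<longleftrightarrow> {y, z} \<in> red H"
  using assms x unfolding contract_def by (auto simp: doubleton_eq_iff)

lemma contract_new:
  assumes y: "y \<in> tverts H - {u, v}"
  shows "{x, y} \<in> black (contract H u v x) \<longleftrightarrow> {u, y} \<in> black H \<and> {v, y} \<in> black H"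
    "{x, y} \<in> red (contract H u v x) \<longleftrightarrow>
      ({u, y} \<in> black H \<union> red H \<or> {v, y} \<in> black H \<union> red H) \<and>
      \<not> ({u, y} \<in> black H \<and> {v, y} \<in> black H)"
proof -
  have E: "x \<in> {u, v}" if "{x, y} \<in> black H \<union> red H"
    using H x that unfolding trigraph_def by blast
  have "y \<noteq> x" using x y by blast
  then show "{x, y} \<in> black (contract H u v x) \<longleftrightarrow> {u, y} \<in> black H \<and> {v, y} \<in> black H"
    "{x, y} \<in> red (contract H u v x) \<longleftrightarrow>
      ({u, y} \<in> black H \<union> red H \<or> {v, y} \<in> black H \<union> red H) \<and>
      \<not> ({u, y} \<in> black H \<and> {v, y} \<in> black H)"
    using E y unfolding contract_def by (auto simp: doubleton_eq_iff)
qed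

end

text \<open>A pair in \<open>R\<close> is an edge of \<open>H\<close> and cannot be black there, so
  \<open>f\<close> embeds the \<open>R\<close>-neighbours of \<open>v\<close> into the red
  neighbours of \<open>f v\<close>.\<close>

lemma models_red_degree:
  assumes H: "trigraph H" and m: "models H V E R f" and v: "v \<in> V"
    and R: "\<And>x y. R x y \<Longrightarrow> E x y \<and> x \<noteq> y \<and> y \<in> V" and max: "max_red_degree H \<le> d"
  shows "deg R v \<le> d"
proof -
  have fin: "finite (tverts H)" using H by (simp add: trigraph_def)
  have "f ` {y. R v y} \<subseteq> {y \<in> tverts H. {f v, y} \<in> red H}"
    using m v R unfolding models_def by blast
  then have "card (f ` {y. R v y}) \<le> red_degree H (f v)"
    unfolding red_degree_def using fin by (intro card_mono) auto
  moreover have "inj_on f {y. R v y}"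
    using m R unfolding models_def by (auto intro: inj_on_subset)
  ultimately have "deg R v \<le> red_degree H (f v)" by (simp add: card_image deg_def)
  also have "\<dots> \<le> max_red_degree H"
    unfolding max_red_degree_def using fin m v unfolding models_def by (intro Max_ge) auto
  finally show ?thesis using max by simp
qed

lemma models_restrict:
  assumes "models H V E R f" "W \<subseteq> V"
  shows "models H W (restrict_rel W E) (restrict_rel W R) f"
  using assms unfolding models_def restrict_rel_def by (auto intro: inj_on_subset)

text \<open>Merging an untracked vertex into \<open>u\<close> can only redden edges at
  \<open>u\<close> or add red ones, and \<open>models\<close> permits both: a black edge at
  \<open>x\<close> was black at \<open>u\<close>, and every edge at \<open>u\<close> remains an
  edge.\<close>

lemma models_contract_one:
  assumes H: "trigraph H" and m: "models H V E R f" and x: "x \<notin> tverts H - {u, v}"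
    and sym: "\<And>p q. E p q \<Longrightarrow> E q p" "\<And>p q. R p q \<Longrightarrow> R q p"
    and a: "a \<in> V" "f a = u" and v: "v \<notin> f ` V"
  shows "models (contract H u v x) V E R (f(a := x))"
proof -
  have fV: "f p \<in> tverts H - {u, v}" if "p \<in> V" "p \<noteq> a" for p
    using m a v that unfolding models_def inj_on_def by blast
  have base: "({f p, f q} \<in> black H \<longrightarrow> E p q \<and> \<not> R p q) \<and>
       (E p q \<longrightarrow> {f p, f q} \<in> black H \<union> red H)" if "p \<in> V" "q \<in> V" "p \<noteq> q" for p q
    using m that unfolding models_def by blast
  have "inj_on (f(a := x)) V"
    using m fV x unfolding models_def inj_on_def by (metis fun_upd_apply)
  moreover have "(f(a := x)) ` V \<subseteq> tverts (contract H u v x)"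
    using fV unfolding contract_def by auto
  moreover have "({(f(a := x)) p, (f(a := x)) q} \<in> black (contract H u v x) \<longrightarrow> E p q \<and> \<not> R p q) \<and>
       (E p q \<longrightarrow> {(f(a := x)) p, (f(a := x)) q} \<in> black (contract H u v x) \<union> red (contract H u v x))"
    if pq: "p \<in> V" "q \<in> V" "p \<noteq> q" for p q
  proof -
    have new: "({x, f q} \<in> black (contract H u v x) \<longrightarrow> E a q \<and> \<not> R a q) \<and>
       (E a q \<longrightarrow> {x, f q} \<in> black (contract H u v x) \<union> red (contract H u v x))"
      if "q \<in> V" "q \<noteq> a" for q
      using contract_new[OF H x fV[OF that]] base[OF a(1) that(1)] that(2) a(2) by auto
    consider "p = a" "q \<noteq> a" | "q = a" "p \<noteq> a" | "p \<noteq> a" "q \<noteq> a" using pq by blast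
    then show ?thesis
    proof cases
      case 1
      then show ?thesis using new[of q] pq by simp
    next
      case 2
      then show ?thesis using new[of p] pq sym by (auto simp: insert_commute)
    next
      case 3
      then show ?thesis using contract_old[OF H x fV fV, of p q] base[of p q] pq by simp
    qed
  qed
  ultimately show ?thesis unfolding models_def by blast
qed

text \<open>A black edge at \<open>x\<close> comes from two black edges, which the pair also has as
  black edges, so it stays black there. An edge of the pair at \<open>a\<close> or \<open>b\<close>
  gives an edge of \<open>H\<close> at \<open>u\<close> or \<open>v\<close>, hence one at
  \<open>x\<close>.\<close>

lemma models_contract_two:
  assumes H: "trigraph H" and m: "models H V E R f" and x: "x \<notin> tverts H - {u, v}"
    and sym: "\<And>p q. E p q \<Longrightarrow> E q p" "\<And>p q. R p q \<Longrightarrow> R q p"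
    and a: "a \<in> V" "f a = u" and b: "b \<in> V" "f b = v" and ab: "a \<noteq> b"
  shows "models (contract H u v x) (V - {b}) (contract_edge a b E) (contract_red a b E R) (f(a := x))"
proof -
  let ?E = "contract_edge a b E" and ?R = "contract_red a b E R"
  have fV: "f p \<in> tverts H - {u, v}" if "p \<in> V - {b}" "p \<noteq> a" for p
    using m a b that unfolding models_def inj_on_def by blast
  have base: "({f p, f q} \<in> black H \<longrightarrow> E p q \<and> \<not> R p q) \<and>
       (E p q \<longrightarrow> {f p, f q} \<in> black H \<union> red H)" if "p \<in> V" "q \<in> V" "p \<noteq> q" for p q
    using m that unfolding models_def by blast
  have "inj_on (f(a := x)) (V - {b})"
    using m fV x unfolding models_def inj_on_def by (metis fun_upd_apply DiffE)
  moreover have "(f(a := x)) ` (V - {b}) \<subseteq> tverts (contract H u v x)"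
    using fV unfolding contract_def by auto
  moreover have "({(f(a := x)) p, (f(a := x)) q} \<in> black (contract H u v x) \<longrightarrow> ?E p q \<and> \<not> ?R p q) \<and>
       (?E p q \<longrightarrow> {(f(a := x)) p, (f(a := x)) q} \<in> black (contract H u v x) \<union> red (contract H u v x))"
    if pq: "p \<in> V - {b}" "q \<in> V - {b}" "p \<noteq> q" for p q
  proof -
    have new: "({x, f q} \<in> black (contract H u v x) \<longrightarrow> ?E a q \<and> \<not> ?R a q) \<and>
       (?E a q \<longrightarrow> {x, f q} \<in> black (contract H u v x) \<union> red (contract H u v x))"
      if "q \<in> V - {b}" "q \<noteq> a" for q
    proof -
      have q: "q \<in> V" "q \<noteq> b" using that by auto
      have "?E a q \<longleftrightarrow> E a q \<or> E b q"
        "?R a q \<longleftrightarrow> (E a q \<or> E b q) \<and> \<not> (E a q \<and> \<not> R a q \<and> E b q \<and> \<not> R b q)"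
        using q that(2) ab unfolding contract_red_def contract_edge_def by auto
      then show ?thesis
        using contract_new[OF H x fV[OF that]] base[OF a(1) q(1)] base[OF b(1) q(1)]
          that(2) q(2) a(2) b(2) by auto
    qed
    have cs: "?E p q \<longleftrightarrow> ?E q p" "?R p q \<longleftrightarrow> ?R q p" for p q
    proof -
      have "E p q \<longleftrightarrow> E q p" "R p q \<longleftrightarrow> R q p" for p q using sym by blast+
      note eqs = this[of p q] this[of p a] this[of p b] this[of q a] this[of q b]
      show "?E p q \<longleftrightarrow> ?E q p" using eqs unfolding contract_edge_def by auto
      then show "?R p q \<longleftrightarrow> ?R q p" using eqs unfolding contract_red_def by auto
    qed
    consider "p = a" "q \<noteq> a" | "q = a" "p \<noteq> a" | "p \<noteq> a" "q \<noteq> a" using pq by blast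
    then show ?thesis
    proof cases
      case 1
      then show ?thesis using new[of q] pq by simp
    next
      case 2
      then show ?thesis using new[of p] pq cs by (simp add: insert_commute)
    next
      case 3
      then have "?E p q \<longleftrightarrow> E p q" "?R p q \<longleftrightarrow> E p q \<and> R p q"
        using pq unfolding contract_red_def contract_edge_def by auto
      then show ?thesis using 3 contract_old[OF H x fV fV, of p q] base[of p q] pq by auto
    qed
  qed
  ultimately show ?thesis unfolding models_def by blast
qed

text \<open>A definition cannot quantify over the type of \<open>V\<close>. The vertex type of
  \<open>H\<close> suffices, since tracking starts with vertices of \<open>H\<close> itself and
  \<open>V\<close> only shrinks afterwards.\<close>

definition contains_robust :: "'a trigraph \<Rightarrow> bool" where
  "contains_robust H \<longleftrightarrow> (\<exists>(V :: 'a set) E R f. robust_trigraph V E R \<and> models H V E R f)"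

text \<open>The tracked pair changes only if both contracted vertices are tracked; the red degree
  bound of \<open>H'\<close> then reaches it through \<open>models_red_degree\<close>.\<close>

lemma contains_robust_contraction:
  assumes H: "trigraph H" and c: "contraction H H'" and rob: "contains_robust H"
    and max: "max_red_degree H' \<le> 2"
  shows "contains_robust H'"
proof -
  obtain u v x where uv: "u \<in> tverts H" "v \<in> tverts H" "u \<noteq> v" and x: "x \<notin> tverts H - {u, v}"
    and H': "H' = contract H u v x" using c unfolding contraction_def by blast
  obtain V :: "'a set" and E R f where r: "robust_trigraph V E R" and m: "models H V E R f"
    using rob unfolding contains_robust_def by blast
  interpret robust_trigraph V E R by (fact r)
  have tH': "trigraph H'" unfolding H' using trigraph_contract[OF H uv(1,2) x] .
  consider "u \<in> f ` V" "v \<in> f ` V" | "u \<in> f ` V" "v \<notin> f ` V" | "u \<notin> f ` V" "v \<in> f ` V"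
    | "u \<notin> f ` V" "v \<notin> f ` V" by blast
  then show ?thesis
  proof cases
    case 1
    then obtain a b where ab: "a \<in> V" "f a = u" "b \<in> V" "f b = v" by blast
    then have ne: "a \<noteq> b" using uv by blast
    have m': "models H' (V - {b}) (contract_edge a b E) (contract_red a b E R) (f(a := x))"
      unfolding H' using models_contract_two[OF H m x sym red_sym ab ne] .
    have "contract_edge a b E p q \<and> p \<noteq> q \<and> q \<in> V - {b}" if "contract_red a b E R p q" for p q
      using that ab edge_in' unfolding contract_red_def contract_edge_def by auto
    then have "deg (contract_red a b E R) y \<le> 2" if "y \<in> V - {b}" for y
      using models_red_degree[OF tH' m' that _ max] by blast
    then obtain W where "W \<subseteq> V - {b}" "robust_trigraph W (restrict_rel W (contract_edge a b E))
        (restrict_rel W (contract_red a b E R))"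
      using contract_robust[OF ab(1,3) ne] by blast
    then show ?thesis using models_restrict[OF m'] unfolding contains_robust_def by blast
  next
    case 2
    then obtain a where "a \<in> V" "f a = u" by blast
    then have "models H' V E R (f(a := x))"
      unfolding H' using models_contract_one[OF H m x sym red_sym] 2 by blast
    then show ?thesis using r unfolding contains_robust_def by blast
  next
    case 3
    then obtain a where a: "a \<in> V" "f a = v" by blast
    have "x \<notin> tverts H - {v, u}" using x by blast
    then have "models H' V E R (f(a := x))"
      unfolding H' contract_commute[of H u] using models_contract_one[OF H m _ sym red_sym a 3(1)] by blast
    then show ?thesis using r unfolding contains_robust_def by blast
  next
    case 4
    then have fV: "f p \<in> tverts H - {u, v}" if "p \<in> V" for p
      using m that unfolding models_def by blast
    have "f ` V \<subseteq> tverts H'" using fV unfolding H' contract_def by auto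
    then have "models H' V E R f"
      using m contract_old[OF H x fV fV] unfolding models_def H' by auto
    then show ?thesis using r unfolding contains_robust_def by blast
  qed
qed

lemma contains_robust_card:
  assumes H: "trigraph H" and rob: "contains_robust H"
  shows "2 \<le> card (tverts H)"
proof -
  obtain V :: "'a set" and E R f where r: "robust_trigraph V E R" and m: "models H V E R f"
    using rob unfolding contains_robust_def by blast
  interpret robust_trigraph V E R by (fact r)
  obtain v where v: "v \<in> V" using V_nonempty by blast
  have "{y. E v y} \<subseteq> V" using edge_in' by blast
  then have "deg E v \<le> card V" unfolding deg_def by (intro card_mono finite_V)
  also have "card V = card (f ` V)" using m unfolding models_def by (simp add: card_image)
  also have "\<dots> \<le> card (tverts H)"
    using m H unfolding models_def trigraph_def by (intro card_mono) auto
  finally show ?thesis using deg_2_3[OF v] by linarith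
qed

text \<open>Robustness includes the red degree bound, so \<open>rob\<close> can only promise it
  under this bound. A sequence of width at most 2 supplies the bound for its head \<open>H\<close>,
  and robustness then persists to the last trigraph, which has too few vertices for it.\<close>

lemma contains_robust_tww:
  assumes H: "trigraph H" and rob: "max_red_degree H \<le> 2 \<Longrightarrow> contains_robust H"
    and ne: "tverts H \<noteq> {}"
  shows "3 \<le> tww H"
proof (rule ccontr)
  assume "\<not> ?thesis"
  then have "tww H \<le> 2" by simp
  then obtain Hs where Hs: "contraction_sequence H Hs" and red: "\<And>H'. H' \<in> set Hs \<Longrightarrow> max_red_degree H' \<le> 2"
    using tww_le_iff[OF H ne] by blast
  have "trigraph (Hs ! i) \<and> contains_robust (Hs ! i)" if "i < length Hs" for i
    using that
  proof (induction i)
    case 0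
    then have "Hs ! 0 = H" "H \<in> set Hs"
      using Hs unfolding contraction_sequence_def by (auto simp: hd_conv_nth)
    then show ?case using H rob red by simp
  next
    case (Suc i)
    then have IH: "trigraph (Hs ! i)" "contains_robust (Hs ! i)" by auto
    have c: "contraction (Hs ! i) (Hs ! Suc i)"
      using Hs Suc.prems unfolding contraction_sequence_def by blast
    then obtain u v x where "u \<in> tverts (Hs ! i)" "v \<in> tverts (Hs ! i)"
      "x \<notin> tverts (Hs ! i) - {u, v}" "Hs ! Suc i = contract (Hs ! i) u v x"
      unfolding contraction_def by blast
    then have "trigraph (Hs ! Suc i)" using trigraph_contract[OF IH(1)] by metis
    then show ?case using contains_robust_contraction[OF IH(1) c IH(2) red] Suc.prems by simp
  qed
  then have "2 \<le> card (tverts (last Hs))"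
    using Hs contains_robust_card unfolding contraction_sequence_def
    by (metis last_conv_nth diff_less length_greater_0_conv zero_less_one)
  then show False using Hs unfolding contraction_sequence_def by simp
qed

section \<open>Subdivisions of the complete graph on four vertices\<close>

text \<open>On a longest path all neighbours of the head lie on the path. The head has two of them,
  and the farther one closes a cycle.\<close>

lemma core_contains_cycle:
  assumes fin: "finite (non_isolated F)" and core: "core F" and irrefl: "\<And>x. \<not> F x x"
  obtains c where "3 \<le> length c" "distinct c" "set c \<subseteq> non_isolated F"
    "\<And>i. Suc i < length c \<Longrightarrow> F (c ! i) (c ! Suc i)" "F (last c) (hd c)"
proof -
  define path where "path p \<longleftrightarrow> p \<noteq> [] \<and> distinct p \<and> set p \<subseteq> non_isolated F \<and>
    (\<forall>i. Suc i < length p \<longrightarrow> F (p ! i) (p ! Suc i))" for p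
  have sym: "F y x" if "F x y" for x y using core that unfolding core_def by blast
  obtain x0 y0 where "F x0 y0" using core unfolding core_def by blast
  then have "path [x0]" unfolding path_def non_isolated_def by auto
  moreover have "length p \<le> card (non_isolated F)" if "path p" for p
    using that fin card_mono[OF fin, of "set p"] distinct_card[of p] unfolding path_def by auto
  ultimately have "\<exists>p. path p \<and> (\<forall>q. path q \<longrightarrow> length q \<le> length p)"
    by (intro ex_has_greatest_nat[of path "[x0]" length "Suc (card (non_isolated F))"])
      (auto simp: less_Suc_eq_le)
  then obtain p where p: "path p" and max: "\<And>q. path q \<Longrightarrow> length q \<le> length p" by blast
  have hd0: "hd p = p ! 0" using p unfolding path_def by (simp add: hd_conv_nth)
  have nbr: "\<exists>m. 0 < m \<and> m < length p \<and> p ! m = y" if y: "F (hd p) y" for y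
  proof -
    have "y \<in> set p"
    proof (rule ccontr)
      assume "y \<notin> set p"
      moreover have "F y (hd p)" using sym y by blast
      ultimately have "path (y # p)"
        using p hd0 unfolding path_def non_isolated_def by (auto simp: nth_Cons split: nat.split)
      then show False using max[of "y # p"] by simp
    qed
    then obtain m where "m < length p" "p ! m = y" by (auto simp: in_set_conv_nth)
    moreover have "m \<noteq> 0" using calculation y irrefl hd0 by metis
    ultimately show ?thesis by blast
  qed
  have "hd p \<in> non_isolated F" using p unfolding path_def by auto
  then obtain y z where yz: "F (hd p) y" "F (hd p) z" "z \<noteq> y"
    using core unfolding core_def non_isolated_def by blast
  obtain m n where mn: "0 < m" "m < length p" "p ! m = y" "0 < n" "n < length p" "p ! n = z"
    using nbr yz by metis
  then have "m \<noteq> n" using yz by blast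
  \<comment> \<open>The larger of two distinct positive positions is at least 2, so the cycle has at
    least three vertices.\<close>
  then obtain l where l: "2 \<le> l" "l < length p" "F (hd p) (p ! l)"
    using mn yz by (cases "m < n") (metis One_nat_def Suc_1 Suc_leI le_trans linorder_neqE_nat not_less)+
  let ?c = "take (Suc l) p"
  have len: "length ?c = Suc l" using l by simp
  have "hd ?c = hd p" "last ?c = p ! l"
    using l p unfolding path_def by (auto simp: hd_take last_conv_nth)
  then have "F (last ?c) (hd ?c)" using sym l by simp
  moreover have "set ?c \<subseteq> non_isolated F"
    using p set_take_subset[of "Suc l" p] unfolding path_def by blast
  moreover have "F (?c ! i) (?c ! Suc i)" if "Suc i < length ?c" for i
    using that p l unfolding path_def by auto
  moreover have "distinct ?c" using p unfolding path_def by auto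
  ultimately show ?thesis using that[of ?c] len l by simp
qed

lemma girth_le_core:
  assumes G: "finite (verts G)" "\<And>e. e \<in> edges G \<Longrightarrow> e \<subseteq> verts G \<and> card e = 2"
    and F: "core F" "\<And>x y. F x y \<Longrightarrow> {x, y} \<in> edges G"
  shows "girth G \<le> enat (card (non_isolated F))"
proof -
  have sub: "non_isolated F \<subseteq> verts G" using F G(2) unfolding non_isolated_def by blast
  then have fin: "finite (non_isolated F)" using G(1) finite_subset by blast
  have irr: "\<not> F x x" for x using F(2)[of x x] G(2) by force
  obtain c where c: "3 \<le> length c" "distinct c" "set c \<subseteq> non_isolated F"
    "\<And>i. Suc i < length c \<Longrightarrow> F (c ! i) (c ! Suc i)" "F (last c) (hd c)"
    using core_contains_cycle[OF fin F(1) irr] by blast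
  have "is_cycle G c"
    unfolding is_cycle_def path_edges_def using c F(2) sub by auto
  then have "girth G \<le> enat (length c)" unfolding girth_def by (intro Inf_lower) blast
  also have "length c \<le> card (non_isolated F)"
    using c(2,3) fin by (metis distinct_card card_mono)
  finally show ?thesis by simp
qed

section \<open>Degrees and cores in a subdivision given by oriented paths\<close>

definition branch_pair :: "nat \<Rightarrow> nat \<Rightarrow> bool" where
  "branch_pair i j \<longleftrightarrow> i < 4 \<and> j < 4 \<and> i \<noteq> j"

text \<open>Each path is present in both orientations, \<open>Q i j\<close> running from
  \<open>b i\<close> to \<open>b j\<close>. Edges can thus always be traversed forwards, and facts
  about the start of a path yield those about its end.\<close>

locale K4_subdivision =
  fixes b :: "nat \<Rightarrow> 'a" and Q :: "nat \<Rightarrow> nat \<Rightarrow> 'a list"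
  assumes inj_b: "inj_on b {..<4}"
    and len: "branch_pair i j \<Longrightarrow> 2 \<le> length (Q i j)"
    and distinct_Q: "branch_pair i j \<Longrightarrow> distinct (Q i j)"
    and Q_0: "branch_pair i j \<Longrightarrow> Q i j ! 0 = b i"
    and Q_rev: "branch_pair i j \<Longrightarrow> Q j i = rev (Q i j)"
    and inner_not_branch: "branch_pair i j \<Longrightarrow> 0 < k \<Longrightarrow> Suc k < length (Q i j) \<Longrightarrow> l < 4 \<Longrightarrow> Q i j ! k \<noteq> b l"
    and inner_disjoint: "branch_pair i j \<Longrightarrow> 0 < k \<Longrightarrow> Suc k < length (Q i j) \<Longrightarrow>
      branch_pair i' j' \<Longrightarrow> 0 < k' \<Longrightarrow> Suc k' < length (Q i' j') \<Longrightarrow>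
      Q i j ! k = Q i' j' ! k' \<Longrightarrow> {i, j} = {i', j'}"
begin

lemma pair_sym: "branch_pair i j \<Longrightarrow> branch_pair j i" by (auto simp: branch_pair_def)

lemma len_sym: "branch_pair i j \<Longrightarrow> length (Q j i) = length (Q i j)" using Q_rev by simp

lemma Q_swap: "branch_pair i j \<Longrightarrow> k < length (Q i j) \<Longrightarrow> Q j i ! k = Q i j ! (length (Q i j) - Suc k)"
  using Q_rev by (simp add: rev_nth)

lemma Q_last: "branch_pair i j \<Longrightarrow> Q i j ! (length (Q i j) - 1) = b j"
  using Q_swap[of i j 0] Q_0[OF pair_sym, of i j] len[of i j] by (cases "Q i j = []") auto

definition adj :: "'a \<Rightarrow> 'a \<Rightarrow> bool" where
  "adj x y \<longleftrightarrow> (\<exists>i j k. branch_pair i j \<and> Suc k < length (Q i j) \<and> x = Q i j ! k \<and> y = Q i j ! Suc k)"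

definition vset :: "'a set" where
  "vset = {Q i j ! k | i j k. branch_pair i j \<and> k < length (Q i j)}"

lemma adj_step: "branch_pair i j \<Longrightarrow> Suc k < length (Q i j) \<Longrightarrow> adj (Q i j ! k) (Q i j ! Suc k)"
  unfolding adj_def by blast

lemma adj_in_vset: assumes "adj x y" shows "x \<in> vset"
proof -
  obtain i j k where "branch_pair i j" "Suc k < length (Q i j)" "x = Q i j ! k"
    using assms unfolding adj_def by blast
  moreover then have "k < length (Q i j)" by simp
  ultimately show ?thesis unfolding vset_def by blast
qed

lemma adj_sym: assumes "adj x y" shows "adj y x"
proof -
  obtain i j k where k: "branch_pair i j" "Suc k < length (Q i j)" "x = Q i j ! k" "y = Q i j ! Suc k"
    using assms unfolding adj_def by blast
  let ?m = "length (Q i j) - Suc (Suc k)"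
  have "length (Q i j) - Suc (Suc ?m) = k" using k(2) by linarith
  then have "Q j i ! ?m = y" "Q j i ! Suc ?m = x"
    using Q_swap[OF k(1), of ?m] Q_swap[OF k(1), of "Suc ?m"] k by auto
  moreover have "Suc ?m < length (Q j i)" using k len_sym by simp
  ultimately show ?thesis using adj_step[OF pair_sym[OF k(1)], of ?m] by simp
qed

lemma adj_branch:
  assumes i: "i < 4"
  shows "adj (b i) y \<longleftrightarrow> (\<exists>j. branch_pair i j \<and> y = Q i j ! 1)"
proof
  assume "adj (b i) y"
  then obtain i' j k where k: "branch_pair i' j" "Suc k < length (Q i' j)" "b i = Q i' j ! k" "y = Q i' j ! Suc k"
    unfolding adj_def by blast
  have "k = 0" using inner_not_branch[OF k(1) _ k(2) i] k(3) by (metis gr0I)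
  then have "b i = b i'" using k Q_0 by simp
  then have "i = i'" using inj_b i k(1) unfolding inj_on_def branch_pair_def by auto
  then show "\<exists>j. branch_pair i j \<and> y = Q i j ! 1" using k \<open>k = 0\<close> by auto
next
  assume "\<exists>j. branch_pair i j \<and> y = Q i j ! 1"
  then obtain j where j: "branch_pair i j" "y = Q i j ! 1" by blast
  then show "adj (b i) y" using adj_step[OF j(1), of 0] len[OF j(1)] Q_0[OF j(1)] by simp
qed

lemma adj_inner:
  assumes ij: "branch_pair i j" and k: "0 < k" "Suc k < length (Q i j)"
  shows "adj (Q i j ! k) y \<longleftrightarrow> y = Q i j ! (k - 1) \<or> y = Q i j ! Suc k"
proof
  assume "adj (Q i j ! k) y"
  then obtain i' j' k' where k': "branch_pair i' j'" "Suc k' < length (Q i' j')" "Q i j ! k = Q i' j' ! k'"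
    "y = Q i' j' ! Suc k'" unfolding adj_def by blast
  have "k' \<noteq> 0"
  proof
    assume "k' = 0"
    then have "Q i j ! k = b i'" using k' Q_0 by simp
    then show False using inner_not_branch[OF ij k, of i'] k'(1) by (auto simp: branch_pair_def)
  qed
  then have "{i, j} = {i', j'}" using inner_disjoint[OF ij k k'(1) _ k'(2,3)] by simp
  then consider "i' = i" "j' = j" | "i' = j" "j' = i" by (auto simp: doubleton_eq_iff)
  then show "y = Q i j ! (k - 1) \<or> y = Q i j ! Suc k"
  proof cases
    case 1
    then have "k = k'" using distinct_Q[OF ij] k k' by (simp add: nth_eq_iff_index_eq)
    then show ?thesis using 1 k' by simp
  next
    case 2
    then have l: "Suc k' < length (Q i j)" using k'(2) len_sym[OF ij] by simp
    then have "Q i j ! k = Q i j ! (length (Q i j) - Suc k')"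
      using k'(3) 2 Q_swap[OF ij, of k'] by simp
    then have "k = length (Q i j) - Suc k'"
      using distinct_Q[OF ij] k l by (simp add: nth_eq_iff_index_eq)
    then have "k - 1 = length (Q i j) - Suc (Suc k')" by simp
    then show ?thesis using k'(4) 2 Q_swap[OF ij, of "Suc k'"] l by simp
  qed
next
  assume "y = Q i j ! (k - 1) \<or> y = Q i j ! Suc k"
  moreover have "adj (Q i j ! k) (Q i j ! (k - 1))"
    using adj_sym[OF adj_step[OF ij, of "k - 1"]] k by simp
  ultimately show "adj (Q i j ! k) y" using adj_step[OF ij k(2)] by blast
qed

lemma deg_inner:
  assumes ij: "branch_pair i j" and k: "0 < k" "Suc k < length (Q i j)"
  shows "deg adj (Q i j ! k) = 2"
proof -
  have "{y. adj (Q i j ! k) y} = {Q i j ! (k - 1), Q i j ! Suc k}"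
    using adj_inner[OF assms] by auto
  moreover have "Q i j ! (k - 1) \<noteq> Q i j ! Suc k"
    using distinct_Q[OF ij] k by (simp add: nth_eq_iff_index_eq)
  ultimately show ?thesis by (simp add: deg_def)
qed

text \<open>A path with a single edge has the branch vertex \<open>b j\<close> in position 1, which
  determines \<open>j\<close> and is never an inner vertex; on longer paths position 1 is an inner
  vertex, which determines the path.\<close>

lemma first_inj:
  assumes "branch_pair i j" "branch_pair i l" "Q i j ! 1 = Q i l ! 1"
  shows "j = l"
proof -
  have fin: "Q i j ! 1 = b j" if "branch_pair i j" "\<not> 2 < length (Q i j)" for j
  proof -
    have "length (Q i j) = 2" using len[OF that(1)] that(2) by linarith
    then show ?thesis using Q_last[OF that(1)] by simp
  qed
  have four: "i < 4" "j < 4" "l < 4" using assms by (auto simp: branch_pair_def)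
  consider "2 < length (Q i j)" "2 < length (Q i l)" | "2 < length (Q i j)" "\<not> 2 < length (Q i l)"
    | "\<not> 2 < length (Q i j)" "2 < length (Q i l)" | "\<not> 2 < length (Q i j)" "\<not> 2 < length (Q i l)" by blast
  then show ?thesis
  proof cases
    case 1
    then have "{i, j} = {i, l}" using inner_disjoint[OF assms(1) _ _ assms(2) _ _ assms(3)] by simp
    then show ?thesis by (auto simp: doubleton_eq_iff)
  next
    case 2
    then show ?thesis using fin[OF assms(2)] inner_not_branch[OF assms(1), of 1 l] assms(3) four by simp
  next
    case 3
    then show ?thesis using fin[OF assms(1)] inner_not_branch[OF assms(2), of 1 j] assms(3) four by simp
  next
    case 4
    then have "b j = b l" using fin assms by simp
    then show ?thesis using inj_b four unfolding inj_on_def by simp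
  qed
qed

lemma deg_branch:
  assumes i: "i < 4"
  shows "deg adj (b i) = 3"
proof -
  have "{y. adj (b i) y} = (\<lambda>j. Q i j ! 1) ` ({..<4} - {i})"
    using adj_branch[OF i] i by (auto simp: branch_pair_def)
  moreover have "inj_on (\<lambda>j. Q i j ! 1) ({..<4} - {i})"
    using first_inj i by (auto simp: inj_on_def branch_pair_def)
  ultimately show ?thesis using i by (simp add: deg_def card_image)
qed

lemma vset_cases:
  assumes "x \<in> vset"
  obtains i where "i < 4" "x = b i"
  | i j k where "branch_pair i j" "0 < k" "Suc k < length (Q i j)" "x = Q i j ! k"
proof -
  obtain i j k where k: "branch_pair i j" "k < length (Q i j)" "x = Q i j ! k"
    using assms unfolding vset_def by blast
  consider "k = 0" | "k = length (Q i j) - 1" | "0 < k" "Suc k < length (Q i j)" using k by linarith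
  then show ?thesis
  proof cases
    case 1
    then show ?thesis using k that(1)[of i] Q_0 by (simp add: branch_pair_def)
  next
    case 2
    then show ?thesis using k that(1)[of j] Q_last by (simp add: branch_pair_def)
  next
    case 3
    then show ?thesis using k that(2) by blast
  qed
qed

lemma finite_vset: "finite vset"
proof -
  have "vset \<subseteq> (\<Union>i<4. \<Union>j<4. set (Q i j))" 
  proof
    fix x assume "x \<in> vset"
    then obtain i j k where "i < 4" "j < 4" "k < length (Q i j)" "x = Q i j ! k"
      unfolding vset_def branch_pair_def by blast
    then have "x \<in> set (Q i j)" by simp
    then show "x \<in> (\<Union>i<4. \<Union>j<4. set (Q i j))" using \<open>i < 4\<close> \<open>j < 4\<close> by blast
  qed
  then show ?thesis by (rule finite_subset) auto
qed

text \<open>A core cannot end at a vertex of degree 2, so it follows every path that it enters to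
  the end (\<open>reach\<close>). It hence contains a branch vertex, and two of its edges there lead
  along different paths to two further branch vertices.\<close>

lemma core_three_branches:
  assumes FE: "F \<le> adj" and core: "core F"
  shows "3 \<le> card {v \<in> non_isolated F. deg adj v = 3}"
proof -
  have sym: "F y x" if "F x y" for x y using core that unfolding core_def by blast
  have two: "\<exists>z. z \<noteq> y \<and> F x z" if "F x y" for x y using core that unfolding core_def by blast
  have reach: "b j \<in> non_isolated F"
    if "branch_pair i j" "Suc k < length (Q i j)" "F (Q i j ! k) (Q i j ! Suc k)" for i j k
    using that
  proof (induction "length (Q i j) - k" arbitrary: k rule: less_induct)
    case less
    show ?case
    proof (cases "Suc (Suc k) < length (Q i j)")
      case True
      obtain z where z: "z \<noteq> Q i j ! k" "F (Q i j ! Suc k) z"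
        using two[OF sym[OF less.prems(3)]] by blast
      then have "adj (Q i j ! Suc k) z" using FE by blast
      then have "z = Q i j ! Suc (Suc k)" using adj_inner[OF less.prems(1) _ True] z(1) by simp
      then show ?thesis using less.hyps[of "Suc k"] less.prems True z by simp
    next
      case False
      then have "Suc k = length (Q i j) - 1" using less.prems by linarith
      then have "Q i j ! Suc k = b j" using Q_last less.prems(1) by simp
      then show ?thesis using sym[OF less.prems(3)] unfolding non_isolated_def by auto
    qed
  qed
  obtain x y where "F x y" using core unfolding core_def by blast
  then obtain i j k where "branch_pair i j" "Suc k < length (Q i j)" "F (Q i j ! k) (Q i j ! Suc k)"
    using FE unfolding adj_def by blast
  then have "b j \<in> non_isolated F" and j: "j < 4" using reach by (auto simp: branch_pair_def)
  then obtain y z where yz: "F (b j) y" "F (b j) z" "z \<noteq> y"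
    using two unfolding non_isolated_def by blast
  then have "adj (b j) y" "adj (b j) z" using FE by blast+
  then obtain l m where l: "branch_pair j l" "y = Q j l ! 1" and m: "branch_pair j m" "z = Q j m ! 1"
    using adj_branch[OF j] by blast
  have "b l \<in> non_isolated F" using reach[OF l(1), of 0] len[OF l(1)] Q_0[OF l(1)] l yz by simp
  moreover have "b m \<in> non_isolated F" using reach[OF m(1), of 0] len[OF m(1)] Q_0[OF m(1)] m yz by simp
  moreover have ne: "l \<noteq> m" "j \<noteq> l" "j \<noteq> m" "l < 4" "m < 4" using l m yz by (auto simp: branch_pair_def)
  ultimately have "b ` {j, l, m} \<subseteq> {v \<in> non_isolated F. deg adj v = 3}"
    using deg_branch j \<open>b j \<in> non_isolated F\<close> by auto
  moreover have "finite (non_isolated F)"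
  proof (rule finite_subset[OF _ finite_vset])
    show "non_isolated F \<subseteq> vset"
      using FE adj_in_vset unfolding non_isolated_def by blast
  qed
  ultimately have "card (b ` {j, l, m}) \<le> card {v \<in> non_isolated F. deg adj v = 3}"
    by (intro card_mono) auto
  moreover have "inj_on b {j, l, m}" using inj_b ne j by (auto simp: inj_on_def)
  then have "card (b ` {j, l, m}) = card {j, l, m}" by (rule card_image)
  ultimately show ?thesis using ne by simp
qed

text \<open>At the start heaviness comes from the number of vertices alone.\<close>

lemma robust:
  assumes girth: "\<And>F. F \<le> adj \<Longrightarrow> core F \<Longrightarrow> 7 \<le> card (non_isolated F)"
    and R: "\<And>x y. R x y \<Longrightarrow> R y x" "R \<le> adj" "\<And>x. x \<in> vset \<Longrightarrow> deg R x \<le> 2"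
  shows "robust_trigraph vset adj R"
proof
  show "finite vset" by (rule finite_vset)
  have "branch_pair 0 1" by (simp add: branch_pair_def)
  then have "Q 0 1 ! 0 \<in> vset" using len[of 0 1] unfolding vset_def by force
  then show "vset \<noteq> {}" by blast
  show "adj y x" if "adj x y" for x y using adj_sym[OF that] .
  show "\<not> adj x x" for x
    using distinct_Q unfolding adj_def by (auto simp: nth_eq_iff_index_eq)
  show "x \<in> vset" if "adj x y" for x y
    using adj_in_vset[OF that] .
  show "R y x" if "R x y" for x y using R(1)[OF that] .
  show "adj x y" if "R x y" for x y using R(2) that by blast
  show "deg adj x = 2 \<or> deg adj x = 3" if "x \<in> vset" for x
    using vset_cases[OF that] deg_branch deg_inner by metis
  show "deg R x \<le> 2" if "x \<in> vset" for x using R(3)[OF that] .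
  show "3 \<le> card {v \<in> non_isolated F. deg adj v = 3}" if "F \<le> adj" "core F" for F
    using core_three_branches[OF that] .
  show "heavy adj R F" if "F \<le> adj" "core F" for F
    using girth[OF that] unfolding heavy_def by simp
qed

end

section \<open>Orienting the paths of a subdivision\<close>

lemma inner_verts_nth: "x \<in> inner_verts p \<longleftrightarrow> (\<exists>k. 0 < k \<and> Suc k < length p \<and> x = p ! k)"
proof -
  have nth: "butlast (tl p) ! m = p ! Suc m" if "m < length p - 2" for m
    using that by (simp add: nth_butlast nth_tl)
  have "x \<in> inner_verts p \<longleftrightarrow> (\<exists>m < length p - 2. x = butlast (tl p) ! m)"
    unfolding inner_verts_def in_set_conv_nth by (auto simp: numeral_2_eq_2)
  also have "\<dots> \<longleftrightarrow> (\<exists>m < length p - 2. x = p ! Suc m)" using nth by metis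
  also have "\<dots> \<longleftrightarrow> (\<exists>m. Suc (Suc m) < length p \<and> x = p ! Suc m)"
    by (simp add: less_diff_conv)
  also have "\<dots> \<longleftrightarrow> (\<exists>k. 0 < k \<and> Suc k < length p \<and> x = p ! k)"
    by (metis gr0_implies_Suc zero_less_Suc)
  finally show ?thesis .
qed

lemma inner_verts_rev: "inner_verts (rev p) = inner_verts p"
proof -
  have "tl (rev p) = rev (butlast p)" by (metis butlast_rev rev_rev_ident)
  then have "butlast (tl (rev p)) = rev (tl (butlast p))" by (simp add: butlast_rev)
  then show ?thesis unfolding inner_verts_def by (simp add: butlast_tl)
qed

lemma path_edges_rev: "path_edges (rev p) = path_edges p"
proof -
  have sub: "path_edges (rev q) \<subseteq> path_edges q" for q :: "'a list"
  proof
    fix e assume "e \<in> path_edges (rev q)"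
    then obtain i where i: "Suc i < length q" "e = {rev q ! i, rev q ! Suc i}"
      unfolding path_edges_def by auto
    let ?k = "length q - Suc (Suc i)"
    have "rev q ! Suc i = q ! ?k" "rev q ! i = q ! Suc ?k" "Suc ?k < length q"
      using i(1) by (auto simp: rev_nth Suc_diff_Suc)
    then show "e \<in> path_edges q" using i(2) unfolding path_edges_def by (auto simp: insert_commute)
  qed
  show ?thesis using sub[of p] sub[of "rev p"] by auto
qed

lemma subdivision_K4:
  assumes "is_subdivision G (complete_graph 4)"
  obtains b Q where "K4_subdivision b Q"
    "\<And>x y. {x, y} \<in> edges G \<longleftrightarrow> K4_subdivision.adj Q x y"
    "verts G = K4_subdivision.vset Q"
proof -
  let ?K = "complete_graph 4"
  obtain b P where inj: "inj_on b (verts ?K)"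
    and P: "\<And>e. e \<in> edges ?K \<Longrightarrow> 2 \<le> length (P e) \<and> distinct (P e) \<and>
      {hd (P e), last (P e)} = b ` e \<and> inner_verts (P e) \<inter> b ` verts ?K = {}"
    and disj: "\<And>e f. e \<in> edges ?K \<Longrightarrow> f \<in> edges ?K \<Longrightarrow> e \<noteq> f \<Longrightarrow>
      inner_verts (P e) \<inter> inner_verts (P f) = {}"
    and VG: "verts G = b ` verts ?K \<union> (\<Union>e \<in> edges ?K. set (P e))"
    and EG: "edges G = (\<Union>e \<in> edges ?K. path_edges (P e))"
    using assms unfolding is_subdivision_def by metis
  have VK: "verts ?K = {..<4}" by (simp add: complete_graph_def)
  have EK: "e \<in> edges ?K \<longleftrightarrow> (\<exists>i j. branch_pair i j \<and> e = {i, j})" for e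
    unfolding complete_graph_def branch_pair_def by (auto simp: card_2_iff)
  \<comment> \<open>\<open>is_subdivision\<close> gives the ends of \<open>P {i, j}\<close> only as
    an unordered pair, so the path is reversed when it does not start at \<open>b i\<close>.\<close>
  define Q where "Q i j = (if hd (P {i, j}) = b i then P {i, j} else rev (P {i, j}))" for i j
  have bne: "b i \<noteq> b j" if "branch_pair i j" for i j
    using inj that unfolding VK inj_on_def branch_pair_def by auto
  have Pij: "2 \<le> length (P {i, j})" "distinct (P {i, j})"
      "inner_verts (P {i, j}) \<inter> b ` {..<4} = {}"
      "hd (P {i, j}) = b i \<and> last (P {i, j}) = b j \<or> hd (P {i, j}) = b j \<and> last (P {i, j}) = b i"
    if "branch_pair i j" for i j
  proof -
    have "{i, j} \<in> edges ?K" using that EK by blast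
    from P[OF this] show "2 \<le> length (P {i, j})" "distinct (P {i, j})"
      "inner_verts (P {i, j}) \<inter> b ` {..<4} = {}"
      "hd (P {i, j}) = b i \<and> last (P {i, j}) = b j \<or> hd (P {i, j}) = b j \<and> last (P {i, j}) = b i"
      by (auto simp: VK doubleton_eq_iff)
  qed
  have innerQ: "inner_verts (Q i j) = inner_verts (P {i, j})" for i j
    by (simp add: Q_def inner_verts_rev)
  have edgesQ: "path_edges (Q i j) = path_edges (P {i, j})" for i j
    by (simp add: Q_def path_edges_rev)
  have setQ: "set (Q i j) = set (P {i, j})" for i j by (simp add: Q_def)
  have K: "K4_subdivision b Q"
  proof
    show "inj_on b {..<4}" using inj VK by simp
    fix i j assume ij: "branch_pair i j"
    note p = Pij[OF ij]
    show "2 \<le> length (Q i j)" "distinct (Q i j)" using p by (auto simp: Q_def)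
    have "Q i j \<noteq> []" using p by (auto simp: Q_def)
    moreover have "hd (Q i j) = b i" using p by (auto simp: Q_def hd_rev)
    ultimately show "Q i j ! 0 = b i" by (simp add: hd_conv_nth)
    \<comment> \<open>Both orientations come from the same list, and exactly one of them reverses it
      because \<open>b i\<close> and \<open>b j\<close> differ.\<close>
    have "P {j, i} = P {i, j}" by (simp add: insert_commute)
    then show "Q j i = rev (Q i j)" using p bne[OF ij] unfolding Q_def by auto
    fix k assume k: "0 < k" "Suc k < length (Q i j)"
    have inn: "Q i j ! k \<in> inner_verts (P {i, j})" using k innerQ inner_verts_nth by metis
    show "Q i j ! k \<noteq> b l" if "l < 4" for l
      using inn p(3) that by auto
    fix i' j' k'
    assume ij': "branch_pair i' j'" and k': "0 < k'" "Suc k' < length (Q i' j')"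
      and eq: "Q i j ! k = Q i' j' ! k'"
    have inn': "Q i' j' ! k' \<in> inner_verts (P {i', j'})" using k' innerQ inner_verts_nth by metis
    show "{i, j} = {i', j'}"
    proof (rule ccontr)
      assume "{i, j} \<noteq> {i', j'}"
      then have "inner_verts (P {i, j}) \<inter> inner_verts (P {i', j'}) = {}"
        using disj EK ij ij' by blast
      then show False using inn inn' eq by auto
    qed
  qed
  interpret K4_subdivision b Q by (fact K)
  have "{x, y} \<in> edges G \<longleftrightarrow> adj x y" for x y
  proof
    assume "{x, y} \<in> edges G"
    then obtain i j where ij: "branch_pair i j" and "{x, y} \<in> path_edges (Q i j)"
      using EG EK edgesQ by auto
    then obtain k where k: "Suc k < length (Q i j)" "{x, y} = {Q i j ! k, Q i j ! Suc k}"
      unfolding path_edges_def by blast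
    have "adj (Q i j ! k) (Q i j ! Suc k)" using adj_step[OF ij k(1)] .
    then show "adj x y" using k(2) adj_sym by (auto simp: doubleton_eq_iff)
  next
    assume "adj x y"
    then obtain i j k where "branch_pair i j" "Suc k < length (Q i j)" "x = Q i j ! k" "y = Q i j ! Suc k"
      unfolding adj_def by blast
    then have "branch_pair i j" "{x, y} \<in> path_edges (P {i, j})"
      using edgesQ[of i j] unfolding path_edges_def by blast+
    then show "{x, y} \<in> edges G" using EG EK by blast
  qed
  moreover have "verts G = vset"
  proof
    show "verts G \<subseteq> vset"
    proof
      fix x assume "x \<in> verts G"
      then consider i where "i < 4" "x = b i" | i j where "branch_pair i j" "x \<in> set (Q i j)"
        using VG EK setQ VK by auto
      then show "x \<in> vset"
      proof cases
        case 1
        obtain j where "branch_pair i j" using 1(1) that[of 0] that[of 1] unfolding branch_pair_def by force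
        then show ?thesis using 1 Q_0[of i j] len[of i j] unfolding vset_def by force
      next
        case 2
        then show ?thesis unfolding vset_def in_set_conv_nth by blast
      qed
    qed
    show "vset \<subseteq> verts G"
    proof
      fix x assume "x \<in> vset"
      then obtain i j k where "branch_pair i j" "k < length (Q i j)" "x = Q i j ! k"
        unfolding vset_def by blast
      then have "branch_pair i j" "x \<in> set (P {i, j})" using setQ[of i j] nth_mem by blast+
      then show "x \<in> verts G" using VG EK by blast
    qed
  qed
  ultimately show ?thesis using that K by blast
qed

theorem theorem6p6:
  fixes H :: "'a trigraph" and G :: "'a ugraph"
  assumes "trigraph H"
    and "induced_subgraph G (underlying_graph H)"
    and "girth G \<ge> 7"
    and "is_subdivision G (complete_graph 4)"
  shows "tww H \<ge> 3"
proof -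
  obtain b Q where K: "K4_subdivision b Q"
    and EG: "\<And>x y. {x, y} \<in> edges G \<longleftrightarrow> K4_subdivision.adj Q x y"
    and VG: "verts G = K4_subdivision.vset Q"
    using subdivision_K4[OF assms(4)] by blast
  interpret K4_subdivision b Q by (fact K)
  have sub: "verts G \<subseteq> tverts H" and edges: "edges G = {e \<in> black H \<union> red H. e \<subseteq> verts G}"
    using assms(2) unfolding induced_subgraph_def underlying_graph_def by auto
  have two: "card e = 2" if "e \<in> edges G" for e
    using assms(1) that edges unfolding trigraph_def by blast
  have heavy: "7 \<le> card (non_isolated F)" if F: "F \<le> adj" "core F" for F
  proof -
    have "girth G \<le> enat (card (non_isolated F))"
    proof (rule girth_le_core)
      show "finite (verts G)" using finite_vset VG by simp
      show "e \<subseteq> verts G \<and> card e = 2" if "e \<in> edges G" for e using that two edges by blast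
      show "{x, y} \<in> edges G" if "F x y" for x y using that F(1) EG by blast
    qed (fact F(2))
    then have "(7 :: enat) \<le> enat (card (non_isolated F))" using assms(3) by (rule order_trans[rotated])
    then show ?thesis by (simp add: numeral_eq_enat)
  qed
  define R where "R x y \<longleftrightarrow> adj x y \<and> {x, y} \<in> red H" for x y
  have model: "models H vset adj R id"
  proof -
    have "{x, y} \<notin> red H" if "{x, y} \<in> black H" for x y
      using assms(1) that unfolding trigraph_def by blast
    \<comment> \<open>Here it matters that \<open>G\<close> is induced: each black edge of
      \<open>H\<close> between tracked vertices has to be an edge of the pair.\<close>
    moreover have "adj x y \<longleftrightarrow> {x, y} \<in> black H \<union> red H" if "x \<in> vset" "y \<in> vset" for x y
      using that EG[of x y] VG edges by auto
    ultimately show ?thesis using sub VG unfolding models_def R_def by auto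
  qed
  have irr: "\<not> adj x x" for x using EG[of x x] two by force
  have "contains_robust H" if max: "max_red_degree H \<le> 2"
  proof -
    have "robust_trigraph vset adj R"
    proof (rule robust)
      show "R y x" if "R x y" for x y
        using that adj_sym unfolding R_def by (auto simp: insert_commute)
      show "deg R x \<le> 2" if "x \<in> vset" for x
      proof (rule models_red_degree[OF assms(1) model that _ max])
        fix x y assume "R x y"
        then have "adj x y" unfolding R_def by simp
        then show "adj x y \<and> x \<noteq> y \<and> y \<in> vset" using irr adj_in_vset adj_sym by blast
      qed
    qed (use heavy in \<open>auto simp: R_def\<close>)
    then show ?thesis using model unfolding contains_robust_def by blast
  qed
  moreover have "tverts H \<noteq> {}"
  proof -
    have "branch_pair 0 1" by (simp add: branch_pair_def)
    then have "Q 0 1 ! 0 \<in> vset" using len[of 0 1] unfolding vset_def by force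
    then show ?thesis using sub VG by blast
  qed
  ultimately show ?thesis using contains_robust_tww[OF assms(1)] by blast
qed

end
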